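(* Let $L$ be a countably infinite set and consider the edgeless cube $Q_L$. Then: (1) $\mathcal S^{\mathrm{face}}\subsetneq \mathcal L[f_{\mathrm{solved}}]\subseteq \mathcal S$; (2) every configuration in $\mathcal S^{\mathrm{face}}$ is accessible from every configuration in $\mathcal S$ by a basic sequence of length at most $\omega^2$; (3) if $g$ is a legal configuration not in $\mathcal S$ and $f\in\mathcal S$, then $g$ is not accessible from $f$ and $f$ is not accessible from $g$.
   Context: Let $L$ be an infinite set, $-L=\{-r:r\in L\}$ a disjoint copy of $L$, and $0$ a new element; $L^\dagger=-L\cup\{0\}\cup L$ with $-(-r)=r$, $-0=0$. Adjoin $\pm\infty$ with $-(+\infty)=-\infty$ and set $\bar L^\dagger=L^\dagger\cup\{\pm\infty\}$. Points of $U=(\bar L^\dagger)^3$ have coordinates $x,y,z$. The edgeless cube $Q_L$ is the set of cells: points of $U$ with exactly one coordinate in $\{\pm\infty\}$. For $i\in\{x,y,z\}$, $\alpha\in\bar L^\dagger$, the quarter-turn twist $T_{i,\alpha}$ is the permutation of cells fixing every cell $p$ with $p_i\ne\alpha$ and acting on the others by $T_{x,\alpha}(\alpha,y,z)=(\alpha,-z,y)$, $T_{y,\alpha}(x,\alpha,z)=(z,\alpha,-x)$, $T_{z,\alpha}(x,y,\alpha)=(-y,x,\alpha)$; those with $\alpha=\pm\infty$ are face twists. Basic twists are $T,T^2,T^3$ for quarter-turn twists $T$. A basic sequence is a sequence $\langle\sigma_\eta:\eta<\theta\rangle$ of basic twists of ordinal length $\theta$. A configuration is a map $f$ from cells to the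 six colors red, white, green, orange, yellow, blue together with a special value NaC; it is legal if it never takes value NaC. The solved configuration $f_{\mathrm{solved}}$ colors a cell red, blue, white, orange, green, yellow according as $x=+\infty$, $y=+\infty$, $z=+\infty$, $x=-\infty$, $y=-\infty$, $z=-\infty$. A twist $\sigma$ acts by $(\sigma f)(c)=f(\sigma^{-1}c)$. Applying $\langle\sigma_\eta:\eta<\theta\rangle$ to $f_0$ produces $f_{\eta+1}=\sigma_\eta f_\eta$, and for limit $\lambda\le\theta$, $f_\lambda(c)$ is the eventually constant value of $f_\eta(c)$ ($\eta<\lambda$) if it exists and NaC otherwise; $f_\theta$ is the terminal configuration. $f$ is accessible from $f_0$ if it is the terminal configuration of some basic sequence applied to $f_0$. The cluster of a cell $c$ is its orbit under the group generated by all quarter-turn twists. The six center cells (two coordinates equal to $0$) form the center cluster; all other clusters are non-center. A configuration $f$ is standard if it is legal, each non-center cluster contains exactly four cells of each of the six colors, and there is a rotational symmetry $\rho$ of the cube (a map $U\to U$ given by a signed permutation of coordinates of determinant $1$, where the sign acts by the negation on $\bar L^\dagger$) with $f(c)=f_{\mathrm{solved}}(\rho c)$ for every center cell $c$. $\mathcal S$ is the set of standard configurations; $\mathcal S^{\mathrm{face}}$ is the set of standard configurations $f$ with $T f=f$ for every quarter-turn face twist $T$; $\mathcal L[f_{\mathrm{solved}}]$ is the set of legal configurations accessible from $f_{\mathrm{solved}}$. *)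

theory Defs
  imports Main "HOL-Library.Countable_Set" "HOL-Combinatorics.Permutations"
begin

text \<open>L is a type 'l. L-dagger = -L \<union> {0} \<union> L; bar L-dagger adds +inf and -inf.\<close>

datatype 'l dag = Neg 'l | Zero | Pos 'l
datatype 'l ext = Fin "'l dag" | PInf | MInf

fun neg_dag :: "'l dag \<Rightarrow> 'l dag" where
  "neg_dag (Neg r) = Pos r" | "neg_dag Zero = Zero" | "neg_dag (Pos r) = Neg r"

fun neg :: "'l ext \<Rightarrow> 'l ext" where
  "neg (Fin a) = Fin (neg_dag a)" | "neg PInf = MInf" | "neg MInf = PInf"

type_synonym 'l pt = "'l ext \<times> 'l ext \<times> 'l ext"

definition is_inf :: "'l ext \<Rightarrow> bool" where
  "is_inf a \<longleftrightarrow> a = PInf \<or> a = MInf"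

definition is_cell :: "'l pt \<Rightarrow> bool" where
  "is_cell p \<longleftrightarrow> (case p of (x, y, z) \<Rightarrow>
      (is_inf x \<and> \<not> is_inf y \<and> \<not> is_inf z) \<or>
      (\<not> is_inf x \<and> is_inf y \<and> \<not> is_inf z) \<or>
      (\<not> is_inf x \<and> \<not> is_inf y \<and> is_inf z))"

typedef 'l cell = "{p :: 'l pt. is_cell p}"
  by (rule exI[of _ "(PInf, Fin Zero, Fin Zero)"]) (simp add: is_cell_def is_inf_def)

datatype axis = AX | AY | AZ

fun qt_pt :: "axis \<Rightarrow> 'l ext \<Rightarrow> 'l pt \<Rightarrow> 'l pt" where
  "qt_pt AX \<alpha> (x, y, z) = (if x = \<alpha> then (x, neg z, y) else (x, y, z))"
| "qt_pt AY \<alpha> (x, y, z) = (if y = \<alpha> then (z, y, neg x) else (x, y, z))"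
| "qt_pt AZ \<alpha> (x, y, z) = (if z = \<alpha> then (neg y, x, z) else (x, y, z))"

definition qt :: "axis \<Rightarrow> 'l ext \<Rightarrow> 'l cell \<Rightarrow> 'l cell" where
  "qt i \<alpha> c = Abs_cell (qt_pt i \<alpha> (Rep_cell c))"

definition quarter_twists :: "('l cell \<Rightarrow> 'l cell) set" where
  "quarter_twists = {qt i \<alpha> | i \<alpha>. True}"

definition face_twists :: "('l cell \<Rightarrow> 'l cell) set" where
  "face_twists = {qt i \<alpha> | i \<alpha>. \<alpha> = PInf \<or> \<alpha> = MInf}"

definition basic_twists :: "('l cell \<Rightarrow> 'l cell) set" where
  "basic_twists = {T ^^ k | T k. T \<in> quarter_twists \<and> k \<in> {1, 2, 3}}"

datatype colour = Red | White | Green | Orange | Yellow | Blue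

text \<open>A configuration maps cells to a colour or NaC; NaC is represented by None.\<close>
type_synonym 'l config = "'l cell \<Rightarrow> colour option"

definition legal :: "'l config \<Rightarrow> bool" where
  "legal f \<longleftrightarrow> (\<forall>c. f c \<noteq> None)"

definition solved_pt :: "'l pt \<Rightarrow> colour option" where
  "solved_pt p = (case p of (x, y, z) \<Rightarrow>
     if x = PInf then Some Red else if y = PInf then Some Blue
     else if z = PInf then Some White else if x = MInf then Some Orange
     else if y = MInf then Some Green else if z = MInf then Some Yellow else None)"

definition f_solved :: "'l config" where
  "f_solved c = solved_pt (Rep_cell c)"

definition act :: "('l cell \<Rightarrow> 'l cell) \<Rightarrow> 'l config \<Rightarrow> 'l config" where
  "act \<sigma> f = (\<lambda>c. f (inv \<sigma> c))"

text \<open>A basic sequence of ordinal length theta is represented by a well-order r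
  (with order type theta) and a map sigma from Field r to basic twists.
  The value of the eventually constant sequence F(eta)(c), eta ranging over
  {eta. P eta}, or None (NaC) if it is not eventually constant.\<close>
definition evconst :: "'o rel \<Rightarrow> ('o \<Rightarrow> bool) \<Rightarrow> ('o \<Rightarrow> 'l config) \<Rightarrow> 'l config" where
  "evconst r P F = (\<lambda>c.
     if \<exists>v \<eta>0. P \<eta>0 \<and> (\<forall>\<eta>. P \<eta> \<and> (\<eta>0, \<eta>) \<in> r \<longrightarrow> F \<eta> c = v)
     then THE v. \<exists>\<eta>0. P \<eta>0 \<and> (\<forall>\<eta>. P \<eta> \<and> (\<eta>0, \<eta>) \<in> r \<longrightarrow> F \<eta> c = v)
     else None)"

text \<open>F eta is the configuration f_eta before applying sigma_eta (eta in Field r).\<close>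
definition run_ok :: "'o rel \<Rightarrow> ('o \<Rightarrow> 'l cell \<Rightarrow> 'l cell) \<Rightarrow> 'l config \<Rightarrow> ('o \<Rightarrow> 'l config) \<Rightarrow> bool" where
  "run_ok r \<sigma> f0 F \<longleftrightarrow> (\<forall>\<eta>\<in>Field r.
     F \<eta> = (if \<forall>\<zeta>\<in>Field r. (\<eta>, \<zeta>) \<in> r then f0
            else if \<exists>\<zeta>. (\<zeta>, \<eta>) \<in> r \<and> \<zeta> \<noteq> \<eta> \<and>
                        (\<forall>\<xi>. (\<zeta>, \<xi>) \<in> r \<and> (\<xi>, \<eta>) \<in> r \<longrightarrow> \<xi> = \<zeta> \<or> \<xi> = \<eta>)
            then (let \<zeta> = (THE \<zeta>. (\<zeta>, \<eta>) \<in> r \<and> \<zeta> \<noteq> \<eta> \<and>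
                        (\<forall>\<xi>. (\<zeta>, \<xi>) \<in> r \<and> (\<xi>, \<eta>) \<in> r \<longrightarrow> \<xi> = \<zeta> \<or> \<xi> = \<eta>))
                  in act (\<sigma> \<zeta>) (F \<zeta>))
            else evconst r (\<lambda>\<zeta>. (\<zeta>, \<eta>) \<in> r \<and> \<zeta> \<noteq> \<eta>) F))"

definition terminal :: "'o rel \<Rightarrow> ('o \<Rightarrow> 'l cell \<Rightarrow> 'l cell) \<Rightarrow> 'l config \<Rightarrow> ('o \<Rightarrow> 'l config) \<Rightarrow> 'l config" where
  "terminal r \<sigma> f0 F =
     (if Field r = {} then f0
      else if \<exists>m\<in>Field r. \<forall>\<zeta>\<in>Field r. (\<zeta>, m) \<in> r
      then (let m = (THE m. m \<in> Field r \<and> (\<forall>\<zeta>\<in>Field r. (\<zeta>, m) \<in> r)) in act (\<sigma> m) (F m))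
      else evconst r (\<lambda>\<zeta>. \<zeta> \<in> Field r) F)"

definition accessible_via :: "'o rel \<Rightarrow> 'l config \<Rightarrow> 'l config \<Rightarrow> bool" where
  "accessible_via r f0 g \<longleftrightarrow> Well_order r \<and>
     (\<exists>\<sigma> F. (\<forall>\<eta>\<in>Field r. \<sigma> \<eta> \<in> basic_twists) \<and> run_ok r \<sigma> f0 F \<and> g = terminal r \<sigma> f0 F)"

text \<open>Accessibility by basic sequences whose lengths are order types of
  well-orders on the index type 'o.\<close>
definition accessible :: "'o itself \<Rightarrow> 'l config \<Rightarrow> 'l config \<Rightarrow> bool" where
  "accessible _ f0 g \<longleftrightarrow> (\<exists>r :: 'o rel. accessible_via r f0 g)"

definition omega2 :: "(nat \<times> nat) rel" where
  "omega2 = {((a, b), (c, d)). a < c \<or> (a = c \<and> b \<le> d)}"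

definition twist_step :: "('l cell \<times> 'l cell) set" where
  "twist_step = {(c, d). \<exists>T\<in>quarter_twists. d = T c \<or> c = T d}"

text \<open>Orbit of c under the group generated by the quarter-turn twists.\<close>
definition cluster :: "'l cell \<Rightarrow> 'l cell set" where
  "cluster c = {d. (c, d) \<in> twist_step\<^sup>*}"

definition center_cell :: "'l cell \<Rightarrow> bool" where
  "center_cell c \<longleftrightarrow> (case Rep_cell c of (x, y, z) \<Rightarrow>
      (x = Fin Zero \<and> y = Fin Zero) \<or> (x = Fin Zero \<and> z = Fin Zero) \<or> (y = Fin Zero \<and> z = Fin Zero))"

definition noncenter_clusters :: "'l cell set set" where
  "noncenter_clusters = {cluster c | c. \<not> center_cell c}"

text \<open>Rotational symmetries: (rho p)_i = eps_i * p_{pi i}, a signed permutation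
  matrix, with determinant sign(pi) * prod eps_i = 1.\<close>
definition crd :: "'l pt \<Rightarrow> nat \<Rightarrow> 'l ext" where
  "crd p i = (case p of (x, y, z) \<Rightarrow> if i = 0 then x else if i = 1 then y else z)"

definition rot :: "(nat \<Rightarrow> nat) \<Rightarrow> (nat \<Rightarrow> bool) \<Rightarrow> 'l pt \<Rightarrow> 'l pt" where
  "rot \<pi> \<epsilon> p = (let s = (\<lambda>i v. if \<epsilon> i then neg v else v)
                  in (s 0 (crd p (\<pi> 0)), s 1 (crd p (\<pi> 1)), s 2 (crd p (\<pi> 2))))"

definition is_rotation :: "(nat \<Rightarrow> nat) \<Rightarrow> (nat \<Rightarrow> bool) \<Rightarrow> bool" where
  "is_rotation \<pi> \<epsilon> \<longleftrightarrow> \<pi> permutes {0, 1, 2} \<and>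
     sign \<pi> * (\<Prod>i\<in>{0::nat, 1, 2}. if \<epsilon> i then -1 else 1) = (1::int)"

definition standard :: "'l config \<Rightarrow> bool" where
  "standard f \<longleftrightarrow> legal f \<and>
     (\<forall>K\<in>noncenter_clusters. \<forall>col. card {c\<in>K. f c = Some col} = 4) \<and>
     (\<exists>\<pi> \<epsilon>. is_rotation \<pi> \<epsilon> \<and>
        (\<forall>c. center_cell c \<longrightarrow> f c = solved_pt (rot \<pi> \<epsilon> (Rep_cell c))))"

definition S_std :: "'l config set" where
  "S_std = {f. standard f}"

definition S_face :: "'l config set" where
  "S_face = {f. standard f \<and> (\<forall>T\<in>face_twists. act T f = f)}"

definition L_solved :: "'o itself \<Rightarrow> 'l config set" where
  "L_solved t = {f. legal f \<and> accessible t f_solved f}"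

end

theory Submission
  imports Defs "HOL-Combinatorics.Cycles"
begin

text \<open>
  Index the layers by natural numbers: layer \<open>0\<close> consists of the coordinate \<open>0\<close> and layer \<open>n + 1\<close>
  of the two coordinates \<open>\<plusminus>a\<close> for the \<open>n\<close>-th element \<open>a\<close> of \<open>L\<close>.  The finite coordinates of a cell give
  two layers, and twists preserve them.

  Let \<open>p\<close> be a non-center cell, \<open>F\<close> the face twist and \<open>A\<close>, \<open>B\<close> the two slice twists through \<open>p\<close>.
  The only cell of the face that the commutator \<open>[A, B]\<close> moves is \<open>p\<close>, so \<open>[[A, B], F]\<close> is the 3-cycle
  \<open>(p, A p, F p)\<close> on the whole cube.  These 3-cycles connect each cluster and hence yield all its even
  permutations; since colours repeat, every recolouring of a cluster is reached.

  To reach a target invariant under face twists, stage \<open>m\<close> solves all clusters whose smaller layer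
  is \<open>m\<close>.  The clusters with layers \<open>{m, n}\<close>, \<open>n > m\<close>, are treated simultaneously: in \<open>[[A, B], F]\<close> the
  twists \<open>A\<close> (of layer \<open>m\<close>) and \<open>F\<close> are shared, and \<open>B\<close> is replaced by a sequence of length \<open>\<omega>\<close> of
  slice twists, going through the layers \<open>n > m\<close> in turn.  Finitely many such segments suffice, with a bound that is
  uniform in \<open>n\<close>.  Clusters with both layers below \<open>m\<close> are never disturbed, because there the
  configuration already agrees with the target, which face twists fix.

  Conversely, a finite cluster that becomes constant before a limit keeps its colour count, and NaC
  can never leave a cluster; so being standard is invariant under accessibility between legal
  configurations.
\<close>

section \<open>Cells, twists and clusters\<close>

lemma neg_dag_neg_dag [simp]: "neg_dag (neg_dag u) = u"
  by (cases u) auto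

lemma neg_neg [simp]: "neg (neg x) = x"
  by (cases x) auto

lemma neg_dag_eq_self_iff: "neg_dag u = u \<longleftrightarrow> u = Zero"
  by (cases u) auto

lemma is_inf_simps [simp]: "is_inf PInf" "is_inf MInf" "\<not> is_inf (Fin u)"
  by (simp_all add: is_inf_def)

lemma UNIV_colour: "UNIV = {Red, White, Green, Orange, Yellow, Blue}"
  using colour.exhaust by blast

lemma finite_UNIV_colour [simp]: "finite (UNIV :: colour set)"
  by (simp add: UNIV_colour)

text \<open>
  The order of \<open>u\<close> and \<open>v\<close> on each face is chosen so that every rotation of the cube acts on \<open>(u, v)\<close>
  by a power of \<open>(u, v) \<mapsto> (-v, u)\<close>.
\<close>

fun face_point :: "colour \<Rightarrow> 'l dag \<times> 'l dag \<Rightarrow> 'l pt" where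
  "face_point Red (u, v) = (PInf, Fin u, Fin v)"
| "face_point Orange (u, v) = (MInf, Fin v, Fin u)"
| "face_point Blue (u, v) = (Fin v, PInf, Fin u)"
| "face_point Green (u, v) = (Fin u, MInf, Fin v)"
| "face_point White (u, v) = (Fin u, Fin v, PInf)"
| "face_point Yellow (u, v) = (Fin v, Fin u, MInf)"

definition face_cell :: "colour \<Rightarrow> 'l dag \<times> 'l dag \<Rightarrow> 'l cell" where
  "face_cell col w = Abs_cell (face_point col w)"

lemma Rep_face_cell [simp]: "Rep_cell (face_cell col w) = face_point col w"
  unfolding face_cell_def by (rule Abs_cell_inverse) (cases col; cases w; simp add: is_cell_def)

lemma face_point_exhaust:
  assumes "is_cell p"
  obtains col u v where "p = face_point col (u, v)"
proof -
  obtain x y z where p: "p = (x, y, z)" by (cases p)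
  have "\<exists>col u v. p = face_point col (u, v)"
    using assms unfolding p
    by (cases x; cases y; cases z) (simp_all add: is_cell_def, (metis face_point.simps)+)
  with that show ?thesis by blast
qed

lemma face_cell_exhaust [case_names face_cell, cases type: cell]:
  obtains col u v where "c = face_cell col (u, v)"
  using face_point_exhaust[of "Rep_cell c"] Rep_cell[of c]
  by (metis Rep_cell_inverse face_cell_def mem_Collect_eq)

lemma face_cell_eq_iff [simp]: "face_cell col w = face_cell col' w' \<longleftrightarrow> col = col' \<and> w = w'"
proof -
  have "face_point col w = face_point col' w' \<longleftrightarrow> col = col' \<and> w = w'"
    by (cases w; cases w'; cases col; cases col') auto
  then show ?thesis by (simp flip: Rep_cell_inject)
qed

lemma f_solved_face_cell [simp]: "f_solved (face_cell col w) = Some col"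
  by (cases col; cases w) (simp_all add: f_solved_def solved_pt_def)

lemma center_face_cell [simp]: "center_cell (face_cell col (u, v)) \<longleftrightarrow> u = Zero \<and> v = Zero"
  by (cases col) (auto simp: center_cell_def)

lemma legal_f_solved: "legal f_solved"
  unfolding legal_def by (metis face_cell_exhaust f_solved_face_cell option.distinct(1))

fun coord_pt :: "axis \<Rightarrow> 'l pt \<Rightarrow> 'l ext" where
  "coord_pt AX (x, y, z) = x" | "coord_pt AY (x, y, z) = y" | "coord_pt AZ (x, y, z) = z"

abbreviation coord :: "axis \<Rightarrow> 'l cell \<Rightarrow> 'l ext" where
  "coord i c \<equiv> coord_pt i (Rep_cell c)"

lemma cell_eqI: "(\<And>i. coord i c = coord i d) \<Longrightarrow> c = d"
  by (metis Rep_cell_inject coord_pt.simps prod_cases3)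

lemma Rep_qt [simp]: "Rep_cell (qt i \<alpha> c) = qt_pt i \<alpha> (Rep_cell c)"
  unfolding qt_def
proof (rule Abs_cell_inverse)
  obtain col u v where c: "c = face_cell col (u, v)" by (cases c)
  show "qt_pt i \<alpha> (Rep_cell c) \<in> {p. is_cell p}"
    unfolding c by (cases col; cases i) (auto simp: is_cell_def)
qed

lemma qt_funpow_4: "qt i \<alpha> ^^ 4 = id"
proof
  have "qt_pt i \<alpha> (qt_pt i \<alpha> (qt_pt i \<alpha> (qt_pt i \<alpha> p))) = p" for p
    by (cases p; cases i) auto
  then show "(qt i \<alpha> ^^ 4) c = id c" for c
    by (simp add: eval_nat_numeral flip: Rep_cell_inject)
qed

lemma bij_qt [simp]: "bij (qt i \<alpha>)"
  using qt_funpow_4[of i \<alpha>] by (intro o_bij[of "qt i \<alpha> ^^ 3"]) (simp_all add: eval_nat_numeral comp_assoc)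

lemma inv_qt: "inv (qt i \<alpha>) = qt i \<alpha> ^^ 3"
  using qt_funpow_4[of i \<alpha>] by (intro inv_unique_comp) (simp_all add: eval_nat_numeral comp_assoc)

lemma qt_inv_qt [simp]: "qt i \<alpha> (inv (qt i \<alpha>) c) = c" "inv (qt i \<alpha>) (qt i \<alpha> c) = c"
  by (simp_all add: bij_is_surj bij_is_inj surj_f_inv_f)

lemma funpow_qt_basic:
  assumes "k mod 4 \<noteq> 0"
  shows "qt i \<alpha> ^^ k \<in> basic_twists"
proof -
  have "qt i \<alpha> ^^ k = qt i \<alpha> ^^ (k mod 4)"
    by (metis funpow_mod_eq qt_funpow_4 id_apply ext)
  moreover have "k mod 4 \<in> {1, 2, 3}" using assms by auto
  ultimately show ?thesis unfolding basic_twists_def quarter_twists_def by blast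
qed

lemma qt_basic [simp]: "qt i \<alpha> \<in> basic_twists"
  using funpow_qt_basic[of 1 i \<alpha>] by simp

lemma inv_qt_basic [simp]: "inv (qt i \<alpha>) \<in> basic_twists"
  using funpow_qt_basic[of 3 i \<alpha>] by (simp add: inv_qt)

lemma basic_twistsE:
  assumes "T \<in> basic_twists"
  obtains i \<alpha> k where "T = qt i \<alpha> ^^ k"
  using assms by (auto simp: basic_twists_def quarter_twists_def)

lemma bij_basic_twist: "T \<in> basic_twists \<Longrightarrow> bij T"
  by (auto elim: basic_twistsE intro: bij_fn)

text \<open>Twisting every slice perpendicular to axis \<open>i\<close> at once rotates the whole cube.\<close>

definition rotate_cube :: "axis \<Rightarrow> 'l cell \<Rightarrow> 'l cell" where
  "rotate_cube i c = qt i (coord i c) c"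

lemma qt_eq_rotate: "qt i \<alpha> c = (if coord i c = \<alpha> then rotate_cube i c else c)"
proof -
  have "coord_pt i p \<noteq> \<alpha> \<Longrightarrow> qt_pt i \<alpha> p = p" for p by (cases p; cases i) auto
  then show ?thesis by (simp add: rotate_cube_def flip: Rep_cell_inject)
qed

lemma coord_qt_pt_same [simp]: "coord_pt i (qt_pt i \<alpha> p) = coord_pt i p"
  by (cases p; cases i) simp_all

lemma coord_inv_qt_same [simp]: "coord i (inv (qt i \<alpha>) c) = coord i c"
  by (metis coord_qt_pt_same Rep_qt qt_inv_qt(1))

lemma coord_rotate_same [simp]: "coord i (rotate_cube i c) = coord i c"
  by (simp add: rotate_cube_def)

lemma qt_fixed: "coord i c \<noteq> \<alpha> \<Longrightarrow> qt i \<alpha> c = c"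
  by (simp add: qt_eq_rotate)

lemma inv_qt_fixed: "coord i c \<noteq> \<alpha> \<Longrightarrow> inv (qt i \<alpha>) c = c"
  by (metis qt_fixed qt_inv_qt(2))

lemma twist_step_iff: "(c, d) \<in> twist_step \<longleftrightarrow> (\<exists>i \<alpha>. d = qt i \<alpha> c \<or> c = qt i \<alpha> d)"
  by (auto simp: twist_step_def quarter_twists_def)

lemma cluster_self [simp]: "c \<in> cluster c"
  by (simp add: cluster_def)

lemma cluster_trans: "d \<in> cluster c \<Longrightarrow> e \<in> cluster d \<Longrightarrow> e \<in> cluster c"
  by (auto simp: cluster_def)

lemma cluster_sym: "d \<in> cluster c \<Longrightarrow> c \<in> cluster d"
proof -
  have "sym twist_step" by (auto simp: sym_def twist_step_iff)
  then show "d \<in> cluster c \<Longrightarrow> c \<in> cluster d"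
    unfolding cluster_def by (auto dest: sym_rtrancl symD)
qed

lemma cluster_eq: "d \<in> cluster c \<Longrightarrow> cluster d = cluster c"
  by (blast intro: cluster_trans cluster_sym)

lemma qt_in_cluster: "qt i \<alpha> c \<in> cluster c"
  unfolding cluster_def using twist_step_iff by blast

lemma rotate_in_cluster: "rotate_cube i c \<in> cluster c"
  unfolding rotate_cube_def by (rule qt_in_cluster)

lemma qt_in_cluster_iff [simp]: "qt i \<alpha> d \<in> cluster c \<longleftrightarrow> d \<in> cluster c"
  by (meson cluster_sym cluster_trans qt_in_cluster)

lemma cluster_induct[consumes 1, case_names refl rotate rotate_back]:
  assumes "d \<in> cluster c" "P c"
    and "\<And>i d. d \<in> cluster c \<Longrightarrow> P d \<Longrightarrow> P (rotate_cube i d)"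
    and "\<And>i d. d \<in> cluster c \<Longrightarrow> P (rotate_cube i d) \<Longrightarrow> P d"
  shows "P d"
  using assms(1) unfolding cluster_def mem_Collect_eq
proof (induction rule: rtrancl_induct)
  case base
  show ?case by (rule assms(2))
next
  case (step d d')
  have "d \<in> cluster c" "d' \<in> cluster c"
    using step(1,2) unfolding cluster_def by auto
  with step(2,3) show ?case using assms(3,4) unfolding twist_step_iff qt_eq_rotate by metis
qed

fun turn_face :: "'l dag \<times> 'l dag \<Rightarrow> 'l dag \<times> 'l dag" where
  "turn_face (u, v) = (neg_dag v, u)"

definition turn_orbit :: "'l dag \<times> 'l dag \<Rightarrow> ('l dag \<times> 'l dag) set" where
  "turn_orbit w = {w, turn_face w, turn_face (turn_face w), turn_face (turn_face (turn_face w))}"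

lemma turn_face_4: "turn_face (turn_face (turn_face (turn_face w))) = w"
  by (cases w) simp

lemma finite_turn_orbit [simp]: "finite (turn_orbit w)"
  by (simp add: turn_orbit_def)

lemma card_turn_orbit: "(u, v) \<noteq> (Zero, Zero) \<Longrightarrow> card (turn_orbit (u, v)) = 4"
  by (cases u; cases v) (auto simp: turn_orbit_def)

lemma turn_orbit_self [simp]: "w \<in> turn_orbit w"
  by (simp add: turn_orbit_def)

lemma turn_orbit_eq: "w' \<in> turn_orbit w \<Longrightarrow> turn_orbit w' = turn_orbit w"
  unfolding turn_orbit_def
  by (elim insertE emptyE) (simp_all add: turn_face_4 insert_commute)

lemma turn_orbit_rotate:
  assumes "rotate_cube i (face_cell col w) = face_cell col' w'"
  shows "turn_orbit w' = turn_orbit w"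
proof (rule turn_orbit_eq)
  obtain u v u' v' where w: "w = (u, v)" "w' = (u', v')" by (cases w; cases w')
  have "qt_pt i (coord_pt i (face_point col w)) (face_point col w) = face_point col' w'"
    using assms by (simp add: rotate_cube_def flip: Rep_cell_inject)
  then show "w' \<in> turn_orbit w"
    unfolding w by (cases i; cases col; cases col') (auto simp: turn_orbit_def)
qed

lemma rotate_face_cell:
  "face_cell Red (turn_face w) = rotate_cube AX (face_cell Red w)"
  "face_cell Blue w = rotate_cube AZ (face_cell Red (turn_face w))"
  "face_cell Orange w = rotate_cube AZ (face_cell Blue w)"
  "face_cell Green (turn_face w) = rotate_cube AZ (face_cell Orange w)"
  "face_cell White w = rotate_cube AY (face_cell Orange w)"
  "face_cell Yellow w = rotate_cube AY (face_cell Red w)"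
  by (cases w; simp add: rotate_cube_def flip: Rep_cell_inject)+

lemma Red_turn_in_cluster: "face_cell Red (turn_face w) \<in> cluster (face_cell Red w)"
  unfolding rotate_face_cell(1) by (rule rotate_in_cluster)

lemma face_cell_in_cluster_Red: "face_cell col w \<in> cluster (face_cell Red w)"
proof -
  have Blue: "face_cell Blue w \<in> cluster (face_cell Red w)" for w :: "'a dag \<times> 'a dag"
    unfolding rotate_face_cell(2) using Red_turn_in_cluster rotate_in_cluster cluster_trans by blast
  have Orange: "face_cell Orange w \<in> cluster (face_cell Red w)" for w :: "'a dag \<times> 'a dag"
    unfolding rotate_face_cell(3) using Blue rotate_in_cluster cluster_trans by blast
  have "face_cell Green (turn_face w) \<in> cluster (face_cell Red (turn_face w))" for w :: "'a dag \<times> 'a dag"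
    unfolding rotate_face_cell(4)
    using Orange Red_turn_in_cluster rotate_in_cluster cluster_trans cluster_sym by metis
  then have Green: "face_cell Green w \<in> cluster (face_cell Red w)" by (metis turn_face_4)
  have White: "face_cell White w \<in> cluster (face_cell Red w)"
    unfolding rotate_face_cell(5) using Orange rotate_in_cluster cluster_trans by blast
  show ?thesis
    by (cases col) (simp_all add: Blue Orange Green White rotate_face_cell(6) rotate_in_cluster)
qed

lemma face_cell_in_cluster_iff:
  "face_cell col' w' \<in> cluster (face_cell col w) \<longleftrightarrow> w' \<in> turn_orbit w"
proof
  have "\<forall>col' w'. d = face_cell col' w' \<longrightarrow> turn_orbit w' = turn_orbit w" if "d \<in> cluster (face_cell col w)" for d
    using that
  proof (induction rule: cluster_induct)
    case (rotate i d)
    then show ?case by (metis face_cell_exhaust turn_orbit_rotate)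
  next
    case (rotate_back i d)
    then show ?case by (metis face_cell_exhaust turn_orbit_rotate)
  qed simp
  then show "w' \<in> turn_orbit w" if "face_cell col' w' \<in> cluster (face_cell col w)"
    using that by (metis turn_orbit_self)
next
  assume "w' \<in> turn_orbit w"
  moreover have "face_cell Red (turn_face w'') \<in> cluster (face_cell Red w)"
    if "face_cell Red w'' \<in> cluster (face_cell Red w)" for w''
    using cluster_trans[OF that Red_turn_in_cluster] .
  ultimately have "face_cell Red w' \<in> cluster (face_cell Red w)"
    unfolding turn_orbit_def by (elim insertE emptyE) (simp_all only: cluster_self)
  then show "face_cell col' w' \<in> cluster (face_cell col w)"
    using face_cell_in_cluster_Red cluster_eq by metis
qed

lemma cluster_face_cell: "cluster (face_cell col w) = (\<Union>col'. face_cell col' ` turn_orbit w)"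
proof (rule set_eqI)
  fix d :: "'a cell"
  obtain col' w' where d: "d = face_cell col' w'" by (cases d) blast
  show "d \<in> cluster (face_cell col w) \<longleftrightarrow> d \<in> (\<Union>col'. face_cell col' ` turn_orbit w)"
    unfolding d face_cell_in_cluster_iff by auto
qed

lemma finite_cluster: "finite (cluster c)"
  by (cases c) (simp add: cluster_face_cell)

lemma center_cell_cluster:
  assumes "d \<in> cluster c"
  shows "center_cell d \<longleftrightarrow> center_cell c"
proof -
  obtain col w col' w' where c: "c = face_cell col w" "d = face_cell col' w'"
    by (cases c; cases d) blast
  then have "turn_orbit w' = turn_orbit w"
    using assms by (simp add: face_cell_in_cluster_iff turn_orbit_eq)
  then have "w' = (Zero, Zero) \<longleftrightarrow> w = (Zero, Zero)"
    using turn_orbit_self[of w] turn_orbit_self[of w'] by (auto simp: turn_orbit_def)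
  then show ?thesis unfolding c by (cases w; cases w') simp
qed

lemma card_f_solved_cluster:
  assumes "\<not> center_cell c"
  shows "card {d \<in> cluster c. f_solved d = Some col} = 4"
proof -
  obtain col' u v where c: "c = face_cell col' (u, v)" by (cases c)
  have "{d \<in> cluster c. f_solved d = Some col} = face_cell col ` turn_orbit (u, v)"
    unfolding c cluster_face_cell by auto
  moreover have "inj_on (face_cell col) (turn_orbit (u, v))" by (simp add: inj_on_def)
  moreover have "(u, v) \<noteq> (Zero, Zero)" using assms unfolding c by simp
  ultimately show ?thesis using card_turn_orbit[of u v] by (simp add: card_image)
qed

section \<open>Permutations generated by three-cycles\<close>

primrec words :: "('a \<Rightarrow> 'a) set \<Rightarrow> nat \<Rightarrow> ('a \<Rightarrow> 'a) set" where
  "words E 0 = {id}"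
| "words E (Suc n) = {s \<circ> t | s t. s \<in> E \<and> t \<in> words E n}"

lemma words_mono:
  assumes "id \<in> E" "k \<le> n"
  shows "words E k \<subseteq> words E n"
proof (rule lift_Suc_mono_le[OF _ assms(2)])
  have "t = id \<circ> t" for t :: "'a \<Rightarrow> 'a" by simp
  then show "words E n \<subseteq> words E (Suc n)" for n
    using assms(1) unfolding words.simps by blast
qed

definition comp_closure :: "('a \<Rightarrow> 'a) set \<Rightarrow> ('a \<Rightarrow> 'a) set" where
  "comp_closure E = (\<Union>n. words E n)"

lemma id_in_comp_closure [simp]: "id \<in> comp_closure E"
  unfolding comp_closure_def by (auto intro: exI[of _ 0])

lemma comp_closure_step: "s \<in> E \<Longrightarrow> t \<in> comp_closure E \<Longrightarrow> s \<circ> t \<in> comp_closure E"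
proof -
  assume s: "s \<in> E" and "t \<in> comp_closure E"
  then obtain n where "t \<in> words E n" unfolding comp_closure_def by blast
  with s have "s \<circ> t \<in> words E (Suc n)" unfolding words.simps by blast
  then show "s \<circ> t \<in> comp_closure E" unfolding comp_closure_def by blast
qed

lemma comp_closure_induct [consumes 1, case_names id comp, induct set: comp_closure]:
  assumes "t \<in> comp_closure E" and "P id"
    and "\<And>s t. s \<in> E \<Longrightarrow> t \<in> comp_closure E \<Longrightarrow> P t \<Longrightarrow> P (s \<circ> t)"
  shows "P t"
proof -
  obtain n where "t \<in> words E n" using assms(1) unfolding comp_closure_def by blast
  then show ?thesis
  proof (induction n arbitrary: t)
    case 0
    then have "t = id" by simp
    then show ?case using assms(2) by (simp only:)
  next
    case (Suc n)
    then obtain s t' where t: "t = s \<circ> t'" "s \<in> E" "t' \<in> words E n" by auto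
    then have "t' \<in> comp_closure E" unfolding comp_closure_def by blast
    then show ?case unfolding t(1) using assms(3) t(2,3) Suc.IH by blast
  qed
qed

lemma comp_closure_base: "s \<in> E \<Longrightarrow> s \<in> comp_closure E"
  using comp_closure_step[of s E id] by simp

lemma comp_closure_comp: "s \<in> comp_closure E \<Longrightarrow> t \<in> comp_closure E \<Longrightarrow> s \<circ> t \<in> comp_closure E"
  by (induction rule: comp_closure_induct) (auto simp: comp_assoc intro: comp_closure_step)

lemma comp_closure_inv:
  assumes "t \<in> comp_closure E" and "\<And>s. s \<in> E \<Longrightarrow> bij s \<and> inv s \<in> comp_closure E"
  shows "bij t \<and> inv t \<in> comp_closure E"
  using assms(1)
proof (induction rule: comp_closure_induct)
  case (comp s t)
  then show ?case using assms(2)[of s] by (metis bij_comp o_inv_distrib comp_closure_comp)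
qed (metis bij_id inv_id id_in_comp_closure)

text \<open>
  Because the bound does not depend on \<open>E\<close>, infinitely many clusters can be solved simultaneously in
  finitely many rounds.
\<close>

lemma comp_closure_subset_words:
  assumes "finite K" "card K \<le> m" "\<And>s. s \<in> E \<Longrightarrow> s permutes K"
  shows "comp_closure E \<subseteq> words (insert id E) (fact m * fact m)"
proof
  fix t assume t: "t \<in> comp_closure E"
  define V where "V = {p. p permutes K}"
  define R where "R = {(q, s \<circ> q) | s q. s \<in> E \<and> q \<in> V}"
  have V: "finite V" "card V = fact (card K)"
    unfolding V_def using assms(1) by (simp_all add: finite_permutations card_permutations)
  have R: "R \<subseteq> V \<times> V"
    unfolding R_def V_def using assms(3) permutes_compose by fastforce
  then have "finite R" using V(1) by (meson finite_SigmaI finite_subset)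
  have "card R \<le> card (V \<times> V)" using R V(1) by (intro card_mono) simp_all
  also have "card (V \<times> V) \<le> fact m * fact m"
    unfolding card_cartesian_product V(2) using assms(2) by (intro mult_mono fact_mono_nat) simp_all
  finally have card_R: "card R \<le> fact m * fact m" .
  have "(id, t) \<in> R\<^sup>* \<and> t \<in> V"
    using t
  proof (induction rule: comp_closure_induct)
    case id
    have "id \<in> V" by (simp add: V_def permutes_id)
    then show ?case by blast
  next
    case (comp s t)
    then have "(t, s \<circ> t) \<in> R" unfolding R_def by blast
    then show ?case using comp.IH R by (blast intro: rtrancl.rtrancl_into_rtrancl)
  qed
  then obtain k where k: "k \<le> card R" "(id, t) \<in> R ^^ k"
    using rtrancl_finite_eq_relpow[OF \<open>finite R\<close>] by auto
  have "(id, q) \<in> R ^^ k \<Longrightarrow> q \<in> words (insert id E) k" for q k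
    by (induction k arbitrary: q) (auto simp: R_def)
  then have "t \<in> words (insert id E) k" using k(2) .
  also have "\<dots> \<subseteq> words (insert id E) (fact m * fact m)"
    using k(1) card_R by (intro words_mono) simp_all
  finally show "t \<in> words (insert id E) (fact m * fact m)" .
qed

lemma three_cycle_apply:
  assumes "distinct [x, y, z]"
  shows "cycle_of_list [x, y, z] x = y" "cycle_of_list [x, y, z] y = z" "cycle_of_list [x, y, z] z = x"
    and "u \<notin> {x, y, z} \<Longrightarrow> cycle_of_list [x, y, z] u = u"
  using assms by (auto simp: Transposition.transpose_def)

lemma three_cycle_eqI:
  assumes "distinct [x, y, z]" "p x = y" "p y = z" "p z = x" "\<And>u. u \<notin> {x, y, z} \<Longrightarrow> p u = u"
  shows "p = cycle_of_list [x, y, z]"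
proof
  fix u
  consider "u = x" | "u = y" | "u = z" | "u \<notin> {x, y, z}" by blast
  then show "p u = cycle_of_list [x, y, z] u"
    by cases (metis assms three_cycle_apply)+
qed

lemma three_cycle_square:
  assumes "distinct [x, y, z]"
  shows "cycle_of_list [x, y, z] \<circ> cycle_of_list [x, y, z] = cycle_of_list [y, x, z]"
  by (rule three_cycle_eqI) (use assms in \<open>auto simp: Transposition.transpose_def\<close>)

locale comp_closed =
  fixes G :: "('a \<Rightarrow> 'a) set"
  assumes id_mem: "id \<in> G" and comp_mem: "s \<in> G \<Longrightarrow> t \<in> G \<Longrightarrow> s \<circ> t \<in> G"
begin

definition three_cycle :: "'a \<Rightarrow> 'a \<Rightarrow> 'a \<Rightarrow> bool" where
  "three_cycle x y z \<longleftrightarrow> distinct [x, y, z] \<and> cycle_of_list [x, y, z] \<in> G"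

lemma three_cycle_rotate:
  assumes "three_cycle x y z"
  shows "three_cycle y z x"
proof -
  have distinct: "distinct [x, y, z]" using assms by (simp add: three_cycle_def)
  then have "cycle_of_list [x, y, z] = cycle_of_list [y, z, x]"
    using cycle_of_list_rotate_independent[of "[x, y, z]" 1] by (simp del: cycle_of_list.simps)
  with assms distinct show ?thesis unfolding three_cycle_def by auto
qed

lemma three_cycle_reverse:
  assumes "three_cycle x y z"
  shows "three_cycle y x z"
  using assms comp_mem three_cycle_square[of x y z] unfolding three_cycle_def
  by (metis distinct_length_2_or_more)

lemma three_cycle_conjugate:
  assumes "three_cycle x y z" "three_cycle a b c"
  defines "p \<equiv> cycle_of_list [x, y, z]"
  shows "three_cycle (p a) (p b) (p c)"
proof -
  have xyz: "distinct [x, y, z]" "p \<in> G" and abc: "distinct [a, b, c]" "cycle_of_list [a, b, c] \<in> G"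
    using assms(1,2) unfolding three_cycle_def p_def by blast+
  have bij: "bij p" unfolding p_def by (rule permutation_bijective[OF permutation_of_cycle])
  have square: "p \<circ> p = cycle_of_list [y, x, z]" unfolding p_def by (rule three_cycle_square[OF xyz(1)])
  have "(p \<circ> p) (p u) = u" for u
    unfolding square p_def using xyz(1) by (cases "u \<in> {x, y, z}") auto
  then have inv: "inv p = p \<circ> p" by (intro inv_equality) simp_all
  have "cycle_of_list [p a, p b, p c] = p \<circ> cycle_of_list [a, b, c] \<circ> (p \<circ> p)"
    using conjugation_of_cycle[OF abc(1) bij] by (simp only: inv list.map)
  also have "\<dots> \<in> G" using xyz(2) abc(2) comp_mem by blast
  finally show ?thesis
    using abc(1) bij unfolding three_cycle_def by (simp add: bij_is_inj inj_eq del: cycle_of_list.simps)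
qed

lemma three_cycle_exchange:
  assumes "three_cycle x y z" "three_cycle x w v" "w \<noteq> y" "w \<noteq> z"
  shows "three_cycle x y w"
proof -
  have distinct: "distinct [x, y, z]" "distinct [x, w, v]" using assms(1,2) by (simp_all add: three_cycle_def)
  consider (v_eq_y) "v = y" | (v_eq_z) "v = z" | (all_distinct) "distinct [x, y, z, w, v]"
    using distinct assms(3,4) by auto
  then show ?thesis
  proof cases
    case v_eq_y
    then show ?thesis using assms(2) three_cycle_rotate three_cycle_reverse by blast
  next
    case v_eq_z
    have "three_cycle w y x"
      using three_cycle_conjugate[OF assms(2,1)] three_cycle_apply[OF distinct(2)] distinct(1) assms(3,4) v_eq_z
      by (metis distinct_length_2_or_more insert_iff singletonD)
    then show ?thesis using three_cycle_rotate three_cycle_reverse by blast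
  next
    case all_distinct
    have "three_cycle w y z"
      using three_cycle_conjugate[OF assms(2,1)] three_cycle_apply[OF distinct(2)] all_distinct
      by (metis distinct_length_2_or_more insert_iff singletonD)
    then have "three_cycle y w z" by (rule three_cycle_reverse)
    moreover have "distinct [y, w, z]" "x \<notin> {y, w, z}" using all_distinct by auto
    ultimately have "three_cycle x w y"
      using three_cycle_conjugate[OF _ assms(1)] three_cycle_apply[of y w z] by metis
    then show ?thesis using three_cycle_rotate three_cycle_reverse by blast
  qed
qed

definition joined :: "'a \<Rightarrow> 'a \<Rightarrow> bool" where
  "joined x y \<longleftrightarrow> x = y \<or> (\<exists>z. three_cycle x y z)"

lemma joined_refl [simp]: "joined x x"
  by (simp add: joined_def)

lemma joined_sym: "joined x y \<Longrightarrow> joined y x"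
  unfolding joined_def using three_cycle_reverse by blast

lemma three_cycle_of_joined:
  assumes "joined x y" "joined x w" "distinct [x, y, w]"
  shows "three_cycle x y w"
  using assms three_cycle_exchange unfolding joined_def by (metis distinct_length_2_or_more)

lemma joined_trans: "joined x y \<Longrightarrow> joined y w \<Longrightarrow> joined x w"
  using three_cycle_of_joined[of y x w] three_cycle_rotate joined_sym
  unfolding joined_def by (metis distinct_length_2_or_more distinct_singleton)

lemma transpositions_mem:
  assumes K: "\<And>x y. x \<in> K \<Longrightarrow> y \<in> K \<Longrightarrow> joined x y"
    and "a \<in> K" "b \<in> K" "c \<in> K" "d \<in> K" "a \<noteq> b" "c \<noteq> d"
  shows "transpose a b \<circ> transpose c d \<in> G"
proof -
  have adjacent: "transpose x y \<circ> transpose y z \<in> G" if "x \<in> K" "y \<in> K" "z \<in> K" "x \<noteq> y" "y \<noteq> z" for x y z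
  proof (cases "x = z")
    case True
    then show ?thesis using id_mem by (simp add: transpose_commute)
  next
    case False
    then have "three_cycle x y z" using that K by (intro three_cycle_of_joined) auto
    then show ?thesis by (simp add: three_cycle_def)
  qed
  show ?thesis
  proof (cases "b = c")
    case True
    then show ?thesis using adjacent assms by blast
  next
    case False
    have "transpose a b \<circ> transpose c d = (transpose a b \<circ> transpose b c) \<circ> (transpose b c \<circ> transpose c d)"
      by (simp add: fun_eq_iff)
    then show ?thesis using adjacent comp_mem assms False by metis
  qed
qed

text \<open>Every permutation is even or odd, so it lies in the group up to one transposition.\<close>

lemma permutation_or_transposed_mem:
  assumes K: "\<And>x y. x \<in> K \<Longrightarrow> y \<in> K \<Longrightarrow> joined x y" and "finite K"
    and p: "p permutes K" and zw: "z \<in> K" "w \<in> K" "z \<noteq> w"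
  shows "p \<in> G \<or> transpose z w \<circ> p \<in> G"
  using p \<open>finite K\<close>
proof (induction rule: permutes_induct)
  case id
  show ?case using id_mem by blast
next
  case (swap a b p)
  from \<open>p \<in> G \<or> transpose z w \<circ> p \<in> G\<close> show ?case
  proof
    assume "p \<in> G"
    moreover have "transpose z w \<circ> transpose a b \<in> G"
      using K zw swap(1-3) by (intro transpositions_mem[of K]) auto
    ultimately have "(transpose z w \<circ> transpose a b) \<circ> p \<in> G"
      by (rule comp_mem[rotated])
    then show ?thesis unfolding comp_assoc by blast
  next
    assume "transpose z w \<circ> p \<in> G"
    moreover have "transpose a b \<circ> transpose z w \<in> G"
      using K zw swap(1-3) by (intro transpositions_mem[of K]) auto
    ultimately have "(transpose a b \<circ> transpose z w) \<circ> (transpose z w \<circ> p) \<in> G"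
      by (rule comp_mem[rotated])
    moreover have "(transpose a b \<circ> transpose z w) \<circ> (transpose z w \<circ> p) = transpose a b \<circ> p"
      by (simp add: fun_eq_iff)
    ultimately show ?thesis by metis
  qed
qed

lemma recolour:
  assumes K: "\<And>x y. x \<in> K \<Longrightarrow> y \<in> K \<Longrightarrow> joined x y" and "finite K"
    and card_eq: "\<And>v. card {x \<in> K. f x = v} = card {x \<in> K. g x = v}"
    and zw: "z \<in> K" "w \<in> K" "z \<noteq> w" "g z = g w"
  obtains p where "p \<in> G" "p permutes K" "\<And>x. x \<in> K \<Longrightarrow> f (inv p x) = g x"
proof -
  have "image_mset f (mset_set K) = image_mset g (mset_set K)"
    by (rule multiset_eqI) (simp add: count_image_mset_eq_card_vimage \<open>finite K\<close> card_eq)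
  then obtain q where q: "q permutes K" "\<And>x. x \<in> K \<Longrightarrow> f x = g (q x)"
    using image_mset_eq_implies_permutes[OF \<open>finite K\<close>] by metis
  define q' where "q' = transpose z w \<circ> q"
  have "g (transpose z w x) = g x" for x
    using zw(4) by (cases "x = z \<or> x = w") auto
  then have "f x = g (q' x)" if "x \<in> K" for x using q(2)[OF that] by (simp add: q'_def)
  moreover have "q' permutes K"
    unfolding q'_def using q(1) zw by (intro permutes_compose permutes_swap_id)
  moreover have "q \<in> G \<or> q' \<in> G"
    unfolding q'_def using permutation_or_transposed_mem[OF K \<open>finite K\<close> q(1) zw(1-3)] .
  ultimately obtain p where p: "p \<in> G" "p permutes K" "\<And>x. x \<in> K \<Longrightarrow> f x = g (p x)"
    using q by blast
  show ?thesis
  proof (rule that[OF p(1,2)])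
    fix x assume "x \<in> K"
    then have "inv p x \<in> K" using permutes_in_image[OF permutes_inv[OF p(2)]] by simp
    then show "f (inv p x) = g x" using p(3) permutes_inverses(1)[OF p(2)] by metis
  qed
qed

lemma recolour_disjoint_Union:
  assumes "finite \<K>" "disjoint \<K>"
    and "\<And>K. K \<in> \<K> \<Longrightarrow> \<exists>p\<in>G. p permutes K \<and> (\<forall>x\<in>K. f (inv p x) = g x)"
  shows "\<exists>p\<in>G. p permutes \<Union>\<K> \<and> (\<forall>x\<in>\<Union>\<K>. f (inv p x) = g x)"
  using assms
proof (induction \<K> rule: finite_induct)
  case empty
  show ?case using id_mem permutes_id by auto
next
  case (insert K \<K>)
  have "disjoint \<K>" using insert.prems(1) by (simp add: pairwise_insert)
  then obtain p where p: "p \<in> G" "p permutes \<Union>\<K>" "\<forall>x\<in>\<Union>\<K>. f (inv p x) = g x"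
    using insert.IH insert.prems(2) by (metis insert_iff)
  obtain q where q: "q \<in> G" "q permutes K" "\<forall>x\<in>K. f (inv q x) = g x"
    using insert.prems(2)[of K] by blast
  have disj: "K \<inter> \<Union>\<K> = {}"
    using insert.prems(1) insert.hyps(2) by (fastforce simp: pairwise_insert disjnt_def)
  have inv: "inv (q \<circ> p) = inv p \<circ> inv q"
    using p(2) q(2) by (simp add: o_inv_distrib permutes_bij)
  have "f (inv (q \<circ> p) x) = g x" if "x \<in> \<Union>(insert K \<K>)" for x
  proof (cases "x \<in> K")
    case True
    then have "inv q x \<in> K" using permutes_in_image[OF permutes_inv[OF q(2)]] by simp
    then have "inv p (inv q x) = inv q x"
      using disj permutes_not_in[OF permutes_inv[OF p(2)]] by blast
    then show ?thesis using q(3) True by (simp add: inv)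
  next
    case False
    then have "inv q x = x" using permutes_not_in[OF permutes_inv[OF q(2)]] by blast
    moreover have "f (inv p x) = g x" using p(3) that False by (intro bspec[OF p(3)]) auto
    ultimately show ?thesis by (simp add: inv)
  qed
  moreover have "q \<circ> p permutes \<Union>(insert K \<K>)"
    using permutes_subset[OF p(2)] permutes_subset[OF q(2)] by (intro permutes_compose) auto
  ultimately show ?case using comp_mem[OF q(1) p(1)] by blast
qed

end

lemma comp_closed_comp_closure: "comp_closed (comp_closure E)"
  by unfold_locales (auto intro: comp_closure_comp)

section \<open>Commutators of twists\<close>

definition commutator :: "('a \<Rightarrow> 'a) \<Rightarrow> ('a \<Rightarrow> 'a) \<Rightarrow> 'a \<Rightarrow> 'a" where
  "commutator s t = s \<circ> t \<circ> inv s \<circ> inv t"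

lemma bij_commutator: "bij s \<Longrightarrow> bij t \<Longrightarrow> bij (commutator s t)"
  by (simp add: commutator_def bij_comp bij_imp_bij_inv)

lemma commutator_eq_three_cycle:
  assumes D: "bij D" and F: "bij F" and p: "p \<in> S" "F p \<noteq> p" "D p \<notin> S"
    and F_outside: "\<And>x. x \<notin> S \<Longrightarrow> F x = x" and F_inside: "\<And>x. x \<in> S \<Longrightarrow> F x \<in> S"
    and D_inside: "\<And>x. x \<in> S \<Longrightarrow> x \<noteq> p \<Longrightarrow> D x = x"
  shows "commutator D F = cycle_of_list [p, D p, F p]"
proof (rule three_cycle_eqI)
  have D_inv: "inv D (D x) = x" "D (inv D x) = x" and F_inv: "inv F (F x) = x" "F (inv F x) = x" for x
    using D F by (simp_all add: bij_is_inj bij_is_surj surj_f_inv_f)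
  have inv_F_outside: "inv F x = x" if "x \<notin> S" for x using F_inv(1)[of x] F_outside[OF that] by simp
  have inv_F_inside: "inv F x \<in> S" if "x \<in> S" for x using F_inv(2)[of x] F_outside that by metis
  have inv_D_inside: "inv D x = x" if "x \<in> S" "x \<noteq> p" for x
    using D_inv(1)[of x] D_inside[OF that] by simp
  have inv_D_outside: "inv D x \<notin> S" if "x \<notin> S" "x \<noteq> D p" for x
    using D_inv(2)[of x] D_inside that by metis
  show "distinct [p, D p, F p]" using p F_inside[OF p(1)] by auto
  have "inv F p \<noteq> p" using F_inv(2)[of p] p(2) by auto
  then show "commutator D F p = D p"
    using inv_D_inside inv_F_inside p(1) F_inv(2) by (simp add: commutator_def)
  show "commutator D F (D p) = F p"
    using inv_F_outside[OF p(3)] D_inv(1) D_inside F_inside p by (simp add: commutator_def)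
  have "inv D p \<notin> S" using D_inv(2)[of p] D_inside p(1,3) by metis
  then show "commutator D F (F p) = p"
    using F_outside D_inv(2) F_inv(1) by (simp add: commutator_def)
  fix u assume u: "u \<notin> {p, D p, F p}"
  show "commutator D F u = u"
  proof (cases "u \<in> S")
    case True
    moreover have "inv F u \<noteq> p" using F_inv(2)[of u] u by auto
    ultimately show ?thesis
      using inv_D_inside inv_F_inside F_inv(2) D_inside u by (simp add: commutator_def)
  next
    case False
    then show ?thesis
      using inv_F_outside inv_D_outside F_outside D_inv(2) u by (simp add: commutator_def)
  qed
qed

lemma UNIV_axis: "UNIV = {AX, AY, AZ}"
  using axis.exhaust by blast

lemma ex_axis_iff: "(\<exists>i. P i) \<longleftrightarrow> P AX \<or> P AY \<or> P AZ"
  by (metis axis.exhaust)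

lemma third_axis:
  assumes "i \<noteq> k"
  obtains j :: axis where "distinct [i, j, k]"
proof -
  have "\<exists>j. distinct [i, j, k]" using assms by (cases i; cases k) (auto simp: ex_axis_iff)
  with that show thesis by blast
qed

lemma axis_exhaust: "distinct [i, j, k] \<Longrightarrow> l = i \<or> l = j \<or> (l :: axis) = k"
  by (cases i; cases j; cases k; cases l) auto

lemma is_inf_neg [simp]: "is_inf (neg x) = is_inf x"
  by (cases x) auto

lemma coord_finite:
  assumes "is_inf (coord k c)" "i \<noteq> k"
  obtains s where "coord i c = Fin s"
proof (cases c)
  case (face_cell col u v)
  then show thesis using assms that by (cases col; cases i; cases k) auto
qed

lemma face_axis: obtains k where "is_inf (coord k c)"
proof (cases c)
  case (face_cell col u v)
  then show thesis using that[of AX] that[of AY] that[of AZ] by (cases col) auto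
qed

lemma coord_rotate:
  assumes "distinct [i, j, k]"
  shows "coord k (rotate_cube j c) \<in> {coord i c, neg (coord i c)}"
  using assms unfolding rotate_cube_def
  by (cases "Rep_cell c"; cases i; cases j; cases k) auto

lemma is_inf_coord_rotate: "distinct [i, j, k] \<Longrightarrow> is_inf (coord k (rotate_cube j c)) \<longleftrightarrow> is_inf (coord i c)"
  using coord_rotate[of i j k c] by auto

lemma rotate_leaves_face:
  assumes "is_inf (coord k c)" "i \<noteq> k"
  shows "\<not> is_inf (coord k (rotate_cube i c))"
proof -
  obtain j where j: "distinct [i, j, k]" using third_axis[OF assms(2)] .
  then obtain s where "coord j c = Fin s" using coord_finite[OF assms(1), of j] by auto
  then show ?thesis using is_inf_coord_rotate[of j i k c] j by auto
qed

lemma neg_eq_self_iff: "neg x = x \<longleftrightarrow> x = Fin Zero"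
  by (cases x) (simp_all add: neg_dag_eq_self_iff)

lemma rotate_face_moves:
  assumes "is_inf (coord k c)" "\<not> center_cell c"
  shows "rotate_cube k c \<noteq> c"
proof
  assume "rotate_cube k c = c"
  then have eq: "qt_pt k (coord k c) (Rep_cell c) = Rep_cell c" by (metis Rep_qt rotate_cube_def)
  obtain x y z where c: "Rep_cell c = (x, y, z)" by (cases "Rep_cell c")
  have "center_cell c" using eq unfolding c center_cell_def
    by (cases k) (auto simp: neg_eq_self_iff)
  with assms show False by simp
qed

lemma commutator_slices_on_face:
  assumes ijk: "distinct [i, j, k]" and inf: "is_inf (coord k c)"
  shows "commutator (qt i (Fin s)) (qt j (Fin t)) c =
    (if coord i c = Fin s \<and> coord j c = Fin t then rotate_cube i c else c)"
proof -
  let ?A = "qt i (Fin s)" and ?B = "qt j (Fin t)"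
  have inv_leaves: "coord l (inv (qt l' (Fin r)) c) \<noteq> Fin r'"
    if "distinct [l, l', k]" "coord l' c = Fin r" for l l' r r'
  proof -
    have "rotate_cube l' (inv (qt l' (Fin r)) c) = c"
      by (simp add: rotate_cube_def that(2))
    then have "is_inf (coord l (inv (qt l' (Fin r)) c))"
      using is_inf_coord_rotate[OF that(1), of "inv (qt l' (Fin r)) c"] inf by simp
    then show ?thesis by auto
  qed
  consider (on_B) "coord j c = Fin t" | (only_on_A) "coord j c \<noteq> Fin t" "coord i c = Fin s"
    | (on_neither) "coord j c \<noteq> Fin t" "coord i c \<noteq> Fin s"
    by blast
  then show ?thesis
  proof cases
    case on_B
    then have "coord i (inv ?B c) \<noteq> Fin s" using inv_leaves[of i j] ijk by auto
    then have "inv ?A (inv ?B c) = inv ?B c" by (rule inv_qt_fixed)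
    then have "commutator ?A ?B c = ?A c" by (simp add: commutator_def)
    then show ?thesis using on_B by (simp add: qt_eq_rotate)
  next
    case only_on_A
    then have "coord j (inv ?A c) \<noteq> Fin t" using inv_leaves[of j i] ijk by auto
    then have "?B (inv ?A c) = inv ?A c" by (rule qt_fixed)
    moreover have "inv ?B c = c" by (rule inv_qt_fixed) fact
    ultimately show ?thesis using only_on_A by (simp add: commutator_def)
  next
    case on_neither
    then have "inv ?A c = c" "inv ?B c = c" "?A c = c" "?B c = c"
      by (auto intro: qt_fixed inv_qt_fixed)
    then show ?thesis using on_neither by (simp add: commutator_def)
  qed
qed

lemma nested_commutator_twists:
  assumes ijk: "distinct [i, j, k]" and inf: "is_inf (coord k p)" and "\<not> center_cell p"
  shows "commutator (commutator (qt i (coord i p)) (qt j (coord j p))) (qt k (coord k p)) =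
    cycle_of_list [p, rotate_cube i p, rotate_cube k p]"
proof -
  obtain s t where st: "coord i p = Fin s" "coord j p = Fin t"
    using coord_finite[OF inf] ijk by (metis distinct_length_2_or_more)
  let ?D = "commutator (qt i (Fin s)) (qt j (Fin t))" and ?F = "qt k (coord k p)"
  define S where "S = {c. coord k c = coord k p}"
  have D_on_S: "?D c = (if coord i c = Fin s \<and> coord j c = Fin t then rotate_cube i c else c)" if "c \<in> S" for c
    using commutator_slices_on_face[OF ijk, of c s t] that inf by (simp add: S_def)
  have p_in_S: "p \<in> S" by (simp add: S_def)
  then have D_p: "?D p = rotate_cube i p" using D_on_S[OF p_in_S] by (simp add: st)
  have F_p: "?F p = rotate_cube k p" by (simp add: rotate_cube_def)
  have "commutator ?D ?F = cycle_of_list [p, ?D p, ?F p]"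
  proof (rule commutator_eq_three_cycle[OF _ _ p_in_S])
    show "?F p \<noteq> p" unfolding F_p by (rule rotate_face_moves) fact+
    show "?D p \<notin> S" unfolding D_p S_def using rotate_leaves_face[OF inf, of i] inf ijk by auto
    show "?D c = c" if "c \<in> S" "c \<noteq> p" for c
    proof -
      have "coord l c = coord l p" if "coord i c = Fin s \<and> coord j c = Fin t" for l
        using axis_exhaust[OF ijk, of l] that \<open>c \<in> S\<close> st by (auto simp: S_def)
      then have "\<not> (coord i c = Fin s \<and> coord j c = Fin t)" using cell_eqI \<open>c \<noteq> p\<close> by blast
      then show ?thesis unfolding D_on_S[OF \<open>c \<in> S\<close>] by (rule if_not_P)
    qed
  qed (auto simp: S_def qt_fixed bij_commutator qt_eq_rotate)
  then show ?thesis unfolding D_p F_p st .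
qed

section \<open>Layers\<close>

fun layer :: "('l \<Rightarrow> nat) \<Rightarrow> 'l dag \<Rightarrow> nat" where
  "layer e Zero = 0"
| "layer e (Pos r) = Suc (e r)"
| "layer e (Neg r) = Suc (e r)"

lemma layer_neg_dag [simp]: "layer e (neg_dag s) = layer e s"
  by (cases s) auto

lemma layer_eq_0_iff [simp]: "layer e s = 0 \<longleftrightarrow> s = Zero"
  by (cases s) auto

lemma bounded_layer:
  assumes "inj e"
  shows "finite {s. layer e s = n}" "card {s. layer e s = n} \<le> 3"
proof -
  let ?S = "{Zero, Pos (inv e (n - 1)), Neg (inv e (n - 1))}"
  have sub: "{s. layer e s = n} \<subseteq> ?S"
  proof
    show "s \<in> ?S" if "s \<in> {s. layer e s = n}" for s
      using that inv_f_f[OF assms] by (cases s) auto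
  qed
  then show "finite {s. layer e s = n}" by (rule finite_subset) simp
  have "card {s. layer e s = n} \<le> card ?S" using sub by (intro card_mono) simp_all
  then show "card {s. layer e s = n} \<le> 3" by simp
qed

definition layers :: "('l \<Rightarrow> nat) \<Rightarrow> 'l cell \<Rightarrow> nat set" where
  "layers e c = {layer e s | i s. coord i c = Fin s}"

definition lo_layer :: "('l \<Rightarrow> nat) \<Rightarrow> 'l cell \<Rightarrow> nat" where
  "lo_layer e c = Min (layers e c)"

definition hi_layer :: "('l \<Rightarrow> nat) \<Rightarrow> 'l cell \<Rightarrow> nat" where
  "hi_layer e c = Max (layers e c)"

lemma layers_face_cell: "layers e (face_cell col (u, v)) = {layer e u, layer e v}"
  unfolding layers_def ex_axis_iff by (cases col) auto

lemma layers_eq: "layers e c = {lo_layer e c, hi_layer e c}"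
  by (cases c) (auto simp: lo_layer_def hi_layer_def layers_face_cell)

lemma lo_layer_le_hi_layer: "lo_layer e c \<le> hi_layer e c"
  by (cases c) (simp add: lo_layer_def hi_layer_def layers_face_cell)

lemma layers_rotate [simp]: "layers e (rotate_cube i c) = layers e c"
proof -
  obtain col w col' w' where c: "c = face_cell col w" "rotate_cube i c = face_cell col' w'"
    by (cases c; cases "rotate_cube i c") blast
  then have "w' \<in> turn_orbit w" using turn_orbit_rotate turn_orbit_self by metis
  then have "layers e (face_cell col' w') = layers e (face_cell col w)"
    by (cases w) (auto simp: layers_face_cell turn_orbit_def)
  then show ?thesis using c by metis
qed

lemma layers_qt [simp]: "layers e (qt i \<alpha> c) = layers e c"
  by (simp add: qt_eq_rotate)

lemma layers_inv_qt [simp]: "layers e (inv (qt i \<alpha>) c) = layers e c"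
  by (metis layers_qt qt_inv_qt(1))

lemma qt_fixed_layer: "layer e s \<notin> layers e c \<Longrightarrow> qt i (Fin s) c = c"
  by (rule qt_fixed) (auto simp: layers_def)

lemma layers_face:
  assumes "distinct [i, j, k]" "is_inf (coord k c)" "coord i c = Fin s" "coord j c = Fin t"
  shows "layers e c = {layer e s, layer e t}"
proof -
  have "layers e c = {layer e r | l r. (l = i \<or> l = j \<or> l = k) \<and> coord l c = Fin r}"
    unfolding layers_def using axis_exhaust[OF assms(1)] by blast
  also have "\<dots> = {layer e s, layer e t}" using assms by auto
  finally show ?thesis .
qed

lemma center_cell_iff_hi_layer: "center_cell c \<longleftrightarrow> hi_layer e c = 0"
  by (cases c) (simp add: hi_layer_def layers_face_cell)

definition layer_cells :: "('l \<Rightarrow> nat) \<Rightarrow> nat \<Rightarrow> nat \<Rightarrow> 'l cell set" where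
  "layer_cells e m n = {c. lo_layer e c = m \<and> hi_layer e c = n}"

lemma layers_layer_cells: "c \<in> layer_cells e m n \<Longrightarrow> layers e c = {m, n}"
  by (simp add: layer_cells_def layers_eq)

lemma rotate_in_layer_cells_iff [simp]: "rotate_cube i c \<in> layer_cells e m n \<longleftrightarrow> c \<in> layer_cells e m n"
  by (simp add: layer_cells_def lo_layer_def hi_layer_def)

lemma not_center_cell_layer_cells: "c \<in> layer_cells e m n \<Longrightarrow> 0 < n \<Longrightarrow> \<not> center_cell c"
  by (simp add: layer_cells_def center_cell_iff_hi_layer[of _ e])

lemma cluster_subset_layer_cells:
  assumes "c \<in> layer_cells e m n"
  shows "cluster c \<subseteq> layer_cells e m n"
proof
  show "d \<in> layer_cells e m n" if "d \<in> cluster c" for d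
    using that by (induction rule: cluster_induct) (simp_all add: assms)
qed

lemma bounded_layer_cells:
  assumes "inj e"
  shows "finite (layer_cells e m n)" "card (layer_cells e m n) \<le> 6 * (6 * 6)"
proof -
  define S where "S = {s. layer e s = m} \<union> {s. layer e s = n}"
  define T where "T = (UNIV :: colour set) \<times> (S \<times> S)"
  have "finite S" using bounded_layer(1)[OF assms] by (simp add: S_def)
  have "card S \<le> 3 + 3"
    unfolding S_def using card_Un_le add_mono[OF bounded_layer(2)[OF assms] bounded_layer(2)[OF assms]]
    by (rule order_trans)
  moreover have "card (UNIV :: colour set) \<le> 6" by (simp add: UNIV_colour)
  ultimately have T: "finite T" "card T \<le> 6 * (6 * 6)"
    unfolding T_def card_cartesian_product using \<open>finite S\<close>
    by (simp, intro mult_le_mono) simp_all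
  have sub: "layer_cells e m n \<subseteq> (\<lambda>(col, w). face_cell col w) ` T"
  proof
    fix c assume c: "c \<in> layer_cells e m n"
    obtain col u v where uv: "c = face_cell col (u, v)" by (cases c)
    then have "{layer e u, layer e v} = {m, n}"
      using layers_layer_cells[OF c] by (simp add: layers_face_cell)
    then have "(col, u, v) \<in> T" unfolding T_def S_def by (auto simp: doubleton_eq_iff)
    then show "c \<in> (\<lambda>(col, w). face_cell col w) ` T" unfolding uv by force
  qed
  show "finite (layer_cells e m n)" using sub T(1) by (meson finite_imageI finite_subset)
  show "card (layer_cells e m n) \<le> 6 * (6 * 6)"
    using surj_card_le[OF T(1) sub] T(2) by (rule order_trans)
qed

definition twist_cycles :: "('l \<Rightarrow> nat) \<Rightarrow> nat \<Rightarrow> nat \<Rightarrow> ('l cell \<Rightarrow> 'l cell) set" where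
  "twist_cycles e m n = {cycle_of_list [p, rotate_cube i p, rotate_cube k p] | p i k s.
     p \<in> layer_cells e m n \<and> i \<noteq> k \<and> is_inf (coord k p) \<and> coord i p = Fin s \<and> layer e s = m}"

lemma twist_cycles_permutes:
  assumes "t \<in> twist_cycles e m n"
  shows "t permutes layer_cells e m n"
proof -
  obtain p i k where t: "t = cycle_of_list [p, rotate_cube i p, rotate_cube k p]" "p \<in> layer_cells e m n"
    using assms unfolding twist_cycles_def by blast
  have "set [p, rotate_cube i p, rotate_cube k p] \<subseteq> layer_cells e m n" using t(2) by simp
  then show ?thesis unfolding t(1) by (rule permutes_subset[OF cycle_permutes])
qed

lemma rotate_rotate:
  assumes "distinct [i, j, k]"
  shows "rotate_cube j (rotate_cube k c) = rotate_cube i (rotate_cube j c)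
    \<or> rotate_cube j c = rotate_cube i (rotate_cube j (rotate_cube k c))"
  using assms unfolding rotate_cube_def Rep_cell_inject[symmetric]
  by (cases "Rep_cell c"; cases i; cases j; cases k) simp_all

context
  fixes e :: "'l \<Rightarrow> nat" and m n :: nat
  assumes n: "0 < n"
begin

interpretation comp_closed "comp_closure (twist_cycles e m n)"
  by (rule comp_closed_comp_closure)

lemma three_cycle_twist:
  assumes p: "p \<in> layer_cells e m n" and "i \<noteq> k" "is_inf (coord k p)" "coord i p = Fin s" "layer e s = m"
  shows "three_cycle p (rotate_cube i p) (rotate_cube k p)"
proof -
  have "cycle_of_list [p, rotate_cube i p, rotate_cube k p] \<in> twist_cycles e m n"
    unfolding twist_cycles_def using assms by blast
  moreover have "rotate_cube k p \<noteq> p"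
    using assms(3) not_center_cell_layer_cells[OF p n] by (rule rotate_face_moves)
  moreover have "\<not> is_inf (coord k (rotate_cube i p))"
    by (rule rotate_leaves_face) fact+
  moreover have "is_inf (coord k (rotate_cube k p))" using assms(3) by simp
  ultimately show ?thesis
    unfolding three_cycle_def using assms(3) comp_closure_base
    by (metis distinct_length_2_or_more distinct_singleton)
qed

lemma joined_face_turn:
  assumes p: "p \<in> layer_cells e m n" and k: "is_inf (coord k p)"
  shows "joined p (rotate_cube k p)"
proof -
  obtain i j where ijk: "distinct [i, j, k]"
    by (cases k) (auto intro: that[of AX AY] that[of AY AZ] that[of AX AZ])
  obtain s t where st: "coord i p = Fin s" "coord j p = Fin t"
    using coord_finite[OF k] ijk by (metis distinct_length_2_or_more)
  have "{layer e s, layer e t} = {m, n}"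
    using layers_face[OF ijk k st, of e] layers_layer_cells[OF p] by simp
  then have "layer e s = m \<or> layer e t = m" by (auto simp: doubleton_eq_iff)
  then obtain l where "three_cycle p (rotate_cube l p) (rotate_cube k p)"
    using three_cycle_twist[OF p _ k] st ijk by (metis distinct_length_2_or_more)
  then show ?thesis
    unfolding joined_def using three_cycle_rotate three_cycle_reverse by blast
qed

lemma joined_rotate_turned_face:
  assumes c: "c \<in> layer_cells e m n" and ilk: "distinct [i, l, k]" and k: "is_inf (coord k c)"
  shows "joined (rotate_cube l (rotate_cube k c)) (rotate_cube l c)"
proof -
  have turn: "joined (rotate_cube l d) (rotate_cube i (rotate_cube l d))"
    if "d \<in> layer_cells e m n" "is_inf (coord k d)" for d
    using that is_inf_coord_rotate[of k l i d] ilk by (intro joined_face_turn) auto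
  have "rotate_cube k c \<in> layer_cells e m n" "is_inf (coord k (rotate_cube k c))" using c k by simp_all
  then show ?thesis using rotate_rotate[OF ilk, of c] turn turn[OF c k] joined_sym by metis
qed

text \<open>
  If \<open>l\<close> is not the axis of a twist of layer \<open>m\<close> at \<open>c\<close>, turn the face first: this moves the
  coordinate of layer \<open>m\<close> to axis \<open>l\<close>.
\<close>

lemma joined_rotate:
  assumes c: "c \<in> layer_cells e m n"
  shows "joined c (rotate_cube l c)"
proof -
  obtain k where k: "is_inf (coord k c)" using face_axis .
  show ?thesis
  proof (cases "l = k")
    case True
    then show ?thesis using joined_face_turn[OF c k] by simp
  next
    case False
    then obtain i where "distinct [l, i, k]" by (rule third_axis)
    then have ilk: "distinct [i, l, k]" by auto
    obtain s t where st: "coord i c = Fin s" "coord l c = Fin t"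
      using coord_finite[OF k] ilk by (metis distinct_length_2_or_more)
    have "{layer e s, layer e t} = {m, n}"
      using layers_face[OF ilk k st, of e] layers_layer_cells[OF c] by simp
    then consider (on_axis) "layer e t = m" | (off_axis) "layer e s = m" by (auto simp: doubleton_eq_iff)
    then show ?thesis
    proof cases
      case on_axis
      then show ?thesis using three_cycle_twist[OF c False k st(2)] unfolding joined_def by blast
    next
      case off_axis
      define c' where "c' = rotate_cube k c"
      have c': "c' \<in> layer_cells e m n" "is_inf (coord k c')" using c k by (simp_all add: c'_def)
      have "coord l c' \<in> {Fin s, Fin (neg_dag s)}"
        using coord_rotate[of i k l c] ilk st by (auto simp: c'_def)
      then have "joined c' (rotate_cube l c')"
        using three_cycle_twist[OF c'(1) False c'(2)] off_axis unfolding joined_def by auto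
      moreover have "joined c c'" unfolding c'_def by (rule joined_face_turn) fact+
      moreover have "joined (rotate_cube l c') (rotate_cube l c)"
        unfolding c'_def using c ilk k by (rule joined_rotate_turned_face)
      ultimately show ?thesis using joined_trans by blast
    qed
  qed
qed

lemma joined_cluster:
  assumes "c \<in> layer_cells e m n" "d \<in> cluster c"
  shows "joined c d"
  using assms(2)
proof (induction rule: cluster_induct)
  case (rotate i d)
  then show ?case using joined_rotate joined_trans cluster_subset_layer_cells[OF assms(1)] by blast
next
  case (rotate_back i d)
  then show ?case using joined_rotate joined_trans joined_sym cluster_subset_layer_cells[OF assms(1)] by blast
qed simp

lemma recolour_layer_cells:
  assumes "inj e"
    and card_eq: "\<And>c v. c \<in> layer_cells e m n \<Longrightarrow> card {d \<in> cluster c. f d = v} = card {d \<in> cluster c. g d = v}"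
    and repeated: "\<And>c. c \<in> layer_cells e m n \<Longrightarrow> \<exists>z\<in>cluster c. \<exists>w\<in>cluster c. z \<noteq> w \<and> g z = g w"
  shows "\<exists>p\<in>comp_closure (twist_cycles e m n). p permutes layer_cells e m n \<and>
    (\<forall>c\<in>layer_cells e m n. act p f c = g c)"
proof -
  let ?\<K> = "cluster ` layer_cells e m n"
  have "\<exists>p\<in>comp_closure (twist_cycles e m n). p permutes \<Union>?\<K> \<and> (\<forall>c\<in>\<Union>?\<K>. f (inv p c) = g c)"
  proof (rule recolour_disjoint_Union)
    show "finite ?\<K>" using bounded_layer_cells(1)[OF assms(1)] by (rule finite_imageI)
    show "disjoint ?\<K>"
    proof (rule pairwiseI)
      fix K K' assume "K \<in> ?\<K>" "K' \<in> ?\<K>" "K \<noteq> K'"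
      then show "disjnt K K'" unfolding disjnt_iff using cluster_eq by (metis imageE)
    qed
    fix K assume "K \<in> ?\<K>"
    then obtain c where c: "c \<in> layer_cells e m n" and K: "K = cluster c" by blast
    obtain z w where zw: "z \<in> K" "w \<in> K" "z \<noteq> w" "g z = g w" using repeated[OF c] unfolding K by blast
    have joined: "joined x y" if "x \<in> K" "y \<in> K" for x y
      using joined_trans[OF joined_sym[OF joined_cluster[OF c]] joined_cluster[OF c]] that unfolding K .
    have "finite K" "card {d \<in> K. f d = v} = card {d \<in> K. g d = v}" for v
      unfolding K by (rule finite_cluster, rule card_eq[OF c])
    then obtain p where "p \<in> comp_closure (twist_cycles e m n)" "p permutes K" "\<And>x. x \<in> K \<Longrightarrow> f (inv p x) = g x"
      using recolour[OF joined _ _ zw] by blast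
    then show "\<exists>p\<in>comp_closure (twist_cycles e m n). p permutes K \<and> (\<forall>x\<in>K. f (inv p x) = g x)" by blast
  qed
  moreover have "\<Union>?\<K> = layer_cells e m n"
  proof (intro equalityI subsetI)
    show "d \<in> layer_cells e m n" if "d \<in> \<Union>?\<K>" for d
      using that by (auto dest: cluster_subset_layer_cells[THEN subsetD])
    show "d \<in> \<Union>?\<K>" if "d \<in> layer_cells e m n" for d
      using UN_I[OF that cluster_self] .
  qed
  ultimately show ?thesis by (simp only: act_def)
qed

end

section \<open>Runs along well-orders\<close>

lemma act_apply: "bij T \<Longrightarrow> act T f (T c) = f c"
  by (simp add: act_def bij_is_inj)

lemma act_comp: "bij s \<Longrightarrow> bij t \<Longrightarrow> act (s \<circ> t) f = act s (act t f)"
  by (simp add: act_def o_inv_distrib)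

lemma act_id [simp]: "act id f = f"
  by (simp add: act_def)

definition immediate_pred :: "'o rel \<Rightarrow> 'o \<Rightarrow> 'o \<Rightarrow> bool" where
  "immediate_pred r \<zeta> \<eta> \<longleftrightarrow> (\<zeta>, \<eta>) \<in> r \<and> \<zeta> \<noteq> \<eta> \<and> (\<forall>\<xi>. (\<zeta>, \<xi>) \<in> r \<and> (\<xi>, \<eta>) \<in> r \<longrightarrow> \<xi> = \<zeta> \<or> \<xi> = \<eta>)"

context wo_rel
begin

lemma total: "x \<in> Field r \<Longrightarrow> y \<in> Field r \<Longrightarrow> (x, y) \<in> r \<or> (y, x) \<in> r"
  using TOTALS by blast

lemma antisym: "(x, y) \<in> r \<Longrightarrow> (y, x) \<in> r \<Longrightarrow> x = y"
  using ANTISYM by (rule antisymD)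

lemma evconst_eqI:
  assumes "S \<subseteq> Field r" "\<eta>0 \<in> S" "\<And>\<eta>. \<eta> \<in> S \<Longrightarrow> (\<eta>0, \<eta>) \<in> r \<Longrightarrow> F \<eta> c = v"
  shows "evconst r (\<lambda>\<eta>. \<eta> \<in> S) F c = v"
proof -
  let ?tail = "\<lambda>v. \<exists>\<eta>0. \<eta>0 \<in> S \<and> (\<forall>\<eta>. \<eta> \<in> S \<and> (\<eta>0, \<eta>) \<in> r \<longrightarrow> F \<eta> c = v)"
  have tail_v: "?tail v" using assms(2,3) by blast
  have unique: "w = v" if "?tail w" for w
  proof -
    from that obtain \<eta>1 where \<eta>1: "\<eta>1 \<in> S" "\<And>\<eta>. \<eta> \<in> S \<Longrightarrow> (\<eta>1, \<eta>) \<in> r \<Longrightarrow> F \<eta> c = w" by blast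
    have "\<eta>0 \<in> Field r" "\<eta>1 \<in> Field r" using assms(1,2) \<eta>1(1) by auto
    then have "(\<eta>0, \<eta>1) \<in> r \<or> (\<eta>1, \<eta>0) \<in> r" "(\<eta>0, \<eta>0) \<in> r" "(\<eta>1, \<eta>1) \<in> r"
      using total by blast+
    then show ?thesis using assms(2,3) \<eta>1 by metis
  qed
  have "(THE v. ?tail v) = v" by (rule the_equality[of ?tail, OF tail_v unique])
  moreover have "\<exists>v. ?tail v" using tail_v by blast
  ultimately show ?thesis unfolding evconst_def by simp
qed

lemma evconst_attained:
  assumes "S \<subseteq> Field r" "S \<noteq> {}" "finite K" "\<And>c. c \<in> K \<Longrightarrow> evconst r (\<lambda>\<eta>. \<eta> \<in> S) F c \<noteq> None"
  shows "\<exists>\<eta>\<in>S. \<forall>c\<in>K. F \<eta> c = evconst r (\<lambda>\<eta>. \<eta> \<in> S) F c"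
proof -
  let ?lim = "evconst r (\<lambda>\<eta>. \<eta> \<in> S) F"
  have tail: "\<exists>\<eta>0\<in>S. \<forall>\<eta>\<in>S. (\<eta>0, \<eta>) \<in> r \<longrightarrow> F \<eta> c = ?lim c" if "c \<in> K" for c
  proof -
    have non_None: "?lim c \<noteq> None" by (rule assms(4)[OF that])
    obtain v \<eta>0 where "\<eta>0 \<in> S" "\<forall>\<eta>. \<eta> \<in> S \<and> (\<eta>0, \<eta>) \<in> r \<longrightarrow> F \<eta> c = v"
      using non_None unfolding evconst_def by (auto split: if_splits)
    moreover from this have "?lim c = v" by (intro evconst_eqI[OF assms(1)]) blast+
    ultimately show ?thesis by blast
  qed
  have "\<exists>\<eta>0\<in>S. \<forall>c\<in>K. \<forall>\<eta>\<in>S. (\<eta>0, \<eta>) \<in> r \<longrightarrow> F \<eta> c = ?lim c"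
    using assms(3) tail
  proof (induction K rule: finite_induct)
    case empty
    show ?case using assms(2) by blast
  next
    case (insert c K)
    obtain \<eta>0 where \<eta>0: "\<eta>0 \<in> S" "\<forall>c\<in>K. \<forall>\<eta>\<in>S. (\<eta>0, \<eta>) \<in> r \<longrightarrow> F \<eta> c = ?lim c"
      using insert.IH insert.prems by blast
    obtain \<eta>1 where \<eta>1: "\<eta>1 \<in> S" "\<forall>\<eta>\<in>S. (\<eta>1, \<eta>) \<in> r \<longrightarrow> F \<eta> c = ?lim c"
      using insert.prems by blast
    have "(\<eta>0, \<eta>1) \<in> r \<or> (\<eta>1, \<eta>0) \<in> r" using \<eta>0(1) \<eta>1(1) total assms(1) by blast
    then show ?case
    proof
      assume "(\<eta>0, \<eta>1) \<in> r"
      then show ?thesis using \<eta>0 \<eta>1 TRANS[THEN transD] by (intro bexI[of _ \<eta>1]) blast+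
    next
      assume "(\<eta>1, \<eta>0) \<in> r"
      then show ?thesis using \<eta>0 \<eta>1 TRANS[THEN transD] by (intro bexI[of _ \<eta>0]) blast+
    qed
  qed
  then show ?thesis using total assms(1) by blast
qed

lemma immediate_pred_unique:
  assumes "immediate_pred r \<zeta> \<eta>" "immediate_pred r \<xi> \<eta>"
  shows "\<xi> = \<zeta>"
proof -
  have "\<zeta> \<in> Field r" "\<xi> \<in> Field r" using assms by (auto simp: immediate_pred_def Field_def)
  from total[OF this] show ?thesis using assms unfolding immediate_pred_def by metis
qed

lemma run_ok_iff:
  "run_ok r \<sigma> f0 F \<longleftrightarrow> (\<forall>\<eta>\<in>Field r.
     (underS \<eta> = {} \<longrightarrow> F \<eta> = f0) \<and>
     (\<forall>\<zeta>. immediate_pred r \<zeta> \<eta> \<longrightarrow> F \<eta> = act (\<sigma> \<zeta>) (F \<zeta>)) \<and>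
     (underS \<eta> \<noteq> {} \<and> (\<nexists>\<zeta>. immediate_pred r \<zeta> \<eta>) \<longrightarrow> F \<eta> = evconst r (\<lambda>\<zeta>. \<zeta> \<in> underS \<eta>) F))"
proof -
  have least: "(\<forall>\<zeta>\<in>Field r. (\<eta>, \<zeta>) \<in> r) \<longleftrightarrow> underS \<eta> = {}" if "\<eta> \<in> Field r" for \<eta>
  proof
    assume "\<forall>\<zeta>\<in>Field r. (\<eta>, \<zeta>) \<in> r"
    then have "\<zeta> = \<eta>" if "(\<zeta>, \<eta>) \<in> r" for \<zeta> using antisym that by (meson FieldI1)
    then show "underS \<eta> = {}" by (auto simp: underS_def)
  next
    assume empty: "underS \<eta> = {}"
    show "\<forall>\<zeta>\<in>Field r. (\<eta>, \<zeta>) \<in> r"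
    proof
      fix \<zeta> assume "\<zeta> \<in> Field r"
      with that have "(\<eta>, \<zeta>) \<in> r \<or> (\<zeta>, \<eta>) \<in> r" by (rule total)
      moreover have "\<zeta> = \<eta>" if "(\<zeta>, \<eta>) \<in> r" using empty that by (auto simp: underS_def)
      ultimately show "(\<eta>, \<zeta>) \<in> r" by blast
    qed
  qed
  have underS_nonempty: "immediate_pred r \<zeta> \<eta> \<Longrightarrow> underS \<eta> \<noteq> {}" for \<zeta> \<eta>
    by (auto simp: immediate_pred_def underS_def)
  have the_pred: "(THE \<zeta>. immediate_pred r \<zeta> \<eta>) = \<zeta>" if "immediate_pred r \<zeta> \<eta>" for \<zeta> \<eta>
    using that immediate_pred_unique by blast
  have below: "(\<lambda>\<zeta>. (\<zeta>, \<eta>) \<in> r \<and> \<zeta> \<noteq> \<eta>) = (\<lambda>\<zeta>. \<zeta> \<in> underS \<eta>)" for \<eta>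
    by (auto simp: underS_def)
  show ?thesis
    unfolding run_ok_def immediate_pred_def[symmetric] below Let_def
    by (intro ball_cong) (auto simp: least the_pred dest: underS_nonempty)
qed

lemma terminal_eq_act:
  assumes "m \<in> Field r" "\<forall>\<zeta>\<in>Field r. (\<zeta>, m) \<in> r"
  shows "terminal r \<sigma> f0 F = act (\<sigma> m) (F m)"
proof -
  have "(THE m. m \<in> Field r \<and> (\<forall>\<zeta>\<in>Field r. (\<zeta>, m) \<in> r)) = m"
    using assms antisym by (intro the_equality) blast+
  moreover have "\<exists>m\<in>Field r. \<forall>\<zeta>\<in>Field r. (\<zeta>, m) \<in> r" using assms by blast
  ultimately show ?thesis using assms(1) by (auto simp: terminal_def Let_def)
qed

end

lemma terminal_eq_evconst:
  assumes "Field r \<noteq> {}" "\<nexists>m. m \<in> Field r \<and> (\<forall>\<zeta>\<in>Field r. (\<zeta>, m) \<in> r)"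
  shows "terminal r \<sigma> f0 F = evconst r (\<lambda>\<zeta>. \<zeta> \<in> Field r) F"
proof -
  have "\<not> (\<exists>m\<in>Field r. \<forall>\<zeta>\<in>Field r. (\<zeta>, m) \<in> r)" using assms(2) by blast
  then show ?thesis using assms(1) unfolding terminal_def by (simp only: if_False)
qed

definition twist_closed :: "'l cell set \<Rightarrow> bool" where
  "twist_closed K \<longleftrightarrow> (\<forall>T\<in>basic_twists. \<forall>c. T c \<in> K \<longleftrightarrow> c \<in> K)"

definition local_invariant :: "'l cell set \<Rightarrow> ('l config \<Rightarrow> bool) \<Rightarrow> bool" where
  "local_invariant K \<Psi> \<longleftrightarrow> finite K \<and> twist_closed K \<and>
     (\<forall>T\<in>basic_twists. \<forall>f. \<Psi> (act T f) = \<Psi> f) \<and>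
     (\<forall>f f'. (\<forall>c\<in>K. f c = f' c) \<longrightarrow> \<Psi> f = \<Psi> f')"

lemma local_invariant_finite: "local_invariant K \<Psi> \<Longrightarrow> finite K"
  and local_invariant_act: "local_invariant K \<Psi> \<Longrightarrow> T \<in> basic_twists \<Longrightarrow> \<Psi> (act T f) = \<Psi> f"
  and local_invariant_cong: "local_invariant K \<Psi> \<Longrightarrow> (\<And>c. c \<in> K \<Longrightarrow> f c = f' c) \<Longrightarrow> \<Psi> f = \<Psi> f'"
  by (simp_all add: local_invariant_def)

lemma legal_on_act_iff:
  assumes "twist_closed K" "T \<in> basic_twists"
  shows "(\<forall>c\<in>K. act T f c \<noteq> None) \<longleftrightarrow> (\<forall>c\<in>K. f c \<noteq> None)"
proof -
  have "c \<in> K \<longleftrightarrow> T c \<in> K" for c using assms by (simp add: twist_closed_def)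
  then show ?thesis
    using act_apply[OF bij_basic_twist[OF assms(2)]] bij_pointE[OF bij_basic_twist[OF assms(2)]] by metis
qed

lemma (in wo_rel) local_invariant_run:
  assumes tw: "\<And>\<eta>. \<eta> \<in> Field r \<Longrightarrow> \<sigma> \<eta> \<in> basic_twists" and run: "run_ok r \<sigma> f0 F"
    and inv: "local_invariant K \<Psi>" and "\<eta> \<in> Field r" "\<forall>c\<in>K. F \<eta> c \<noteq> None"
  shows "\<Psi> (F \<eta>) = \<Psi> f0"
  using assms(4,5)
proof (induction \<eta> rule: well_order_induct[case_names below])
  case (below \<eta>)
  consider (least) "underS \<eta> = {}" | (succ) \<zeta> where "immediate_pred r \<zeta> \<eta>"
    | (limit) "underS \<eta> \<noteq> {}" "\<nexists>\<zeta>. immediate_pred r \<zeta> \<eta>" by blast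
  then show ?case
  proof cases
    case least
    then show ?thesis using run below(2) by (simp add: run_ok_iff)
  next
    case (succ \<zeta>)
    then have \<zeta>: "(\<zeta>, \<eta>) \<in> r" "\<zeta> \<noteq> \<eta>" "\<zeta> \<in> Field r" by (auto simp: immediate_pred_def Field_def)
    have F_eq: "F \<eta> = act (\<sigma> \<zeta>) (F \<zeta>)" using run below(2) succ by (simp add: run_ok_iff)
    have "\<forall>c\<in>K. F \<zeta> c \<noteq> None"
      using below(3) legal_on_act_iff tw[OF \<zeta>(3)] inv unfolding F_eq local_invariant_def by blast
    then show ?thesis using below(1) \<zeta> local_invariant_act[OF inv tw[OF \<zeta>(3)]] unfolding F_eq by blast
  next
    case limit
    have F_eq: "F \<eta> = evconst r (\<lambda>\<zeta>. \<zeta> \<in> underS \<eta>) F" using run below(2) limit by (simp add: run_ok_iff)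
    have "underS \<eta> \<subseteq> Field r" by (auto simp: underS_def Field_def)
    then obtain \<zeta> where \<zeta>: "\<zeta> \<in> underS \<eta>" "\<forall>c\<in>K. F \<zeta> c = F \<eta> c"
      using evconst_attained[of "underS \<eta>" K F] limit(1) local_invariant_finite[OF inv] below(3)
      unfolding F_eq[symmetric] by blast
    then have "\<Psi> (F \<zeta>) = \<Psi> f0" using below(1,3) by (fastforce simp: underS_def Field_def)
    then show ?thesis using local_invariant_cong[OF inv] \<zeta>(2) by metis
  qed
qed

lemma local_invariant_accessible:
  assumes "accessible_via r f0 g" and inv: "local_invariant K \<Psi>" and g: "\<forall>c\<in>K. g c \<noteq> None"
  shows "\<Psi> g = \<Psi> f0"
proof -
  from assms(1) obtain \<sigma> F where "Well_order r" and tw: "\<And>\<eta>. \<eta> \<in> Field r \<Longrightarrow> \<sigma> \<eta> \<in> basic_twists"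
    and run: "run_ok r \<sigma> f0 F" and g_terminal: "g = terminal r \<sigma> f0 F"
    unfolding accessible_via_def by blast
  then interpret wo_rel r by unfold_locales
  note run_inv = local_invariant_run[OF tw run inv]
  consider (empty) "Field r = {}" | (last) m where "m \<in> Field r" "\<forall>\<zeta>\<in>Field r. (\<zeta>, m) \<in> r"
    | (limit) "Field r \<noteq> {}" "\<nexists>m. m \<in> Field r \<and> (\<forall>\<zeta>\<in>Field r. (\<zeta>, m) \<in> r)" by blast
  then show ?thesis
  proof cases
    case empty
    then show ?thesis using g_terminal by (simp add: terminal_def)
  next
    case (last m)
    then have g_eq: "g = act (\<sigma> m) (F m)" unfolding g_terminal by (rule terminal_eq_act)
    have "\<forall>c\<in>K. F m c \<noteq> None"
      using g legal_on_act_iff tw[OF last(1)] inv unfolding g_eq local_invariant_def by blast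
    then show ?thesis using run_inv last(1) local_invariant_act[OF inv tw] unfolding g_eq by blast
  next
    case limit
    then have g_eq: "g = evconst r (\<lambda>\<zeta>. \<zeta> \<in> Field r) F" unfolding g_terminal by (rule terminal_eq_evconst)
    then obtain \<zeta> where \<zeta>: "\<zeta> \<in> Field r" "\<forall>c\<in>K. F \<zeta> c = g c"
      using evconst_attained[of "Field r" K F] limit(1) local_invariant_finite[OF inv] g by blast
    then have "\<Psi> (F \<zeta>) = \<Psi> f0" using run_inv g by simp
    then show ?thesis using local_invariant_cong[OF inv] \<zeta>(2) by metis
  qed
qed

section \<open>Standard configurations\<close>

lemma local_invariantI:
  assumes "finite K" and closed: "\<And>i \<alpha> c. qt i \<alpha> c \<in> K \<longleftrightarrow> c \<in> K"
    and cong: "\<And>f f'. (\<And>c. c \<in> K \<Longrightarrow> f c = f' c) \<Longrightarrow> \<Psi> f \<Longrightarrow> \<Psi> f'"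
    and step: "\<And>i \<alpha> f. \<Psi> f \<Longrightarrow> \<Psi> (act (qt i \<alpha>) f)"
  shows "local_invariant K \<Psi>"
proof -
  have bij: "bij (qt i \<alpha> ^^ k)" for i k and \<alpha> :: "'a ext" by (simp add: bij_fn)
  have funpow_closed: "(qt i \<alpha> ^^ k) c \<in> K \<longleftrightarrow> c \<in> K" for i \<alpha> k c
    by (induction k) (simp_all add: closed)
  have funpow_step: "\<Psi> (act (qt i \<alpha> ^^ k) f)" if "\<Psi> f" for i \<alpha> k f
    using that by (induction k) (simp_all add: step act_comp bij)
  have "\<Psi> f" if "\<Psi> (act (qt i \<alpha> ^^ k) f)" for i \<alpha> k f
  proof -
    have "qt i \<alpha> ^^ (3 * k) \<circ> qt i \<alpha> ^^ k = qt i \<alpha> ^^ (4 * k)"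
      by (simp flip: funpow_add)
    also have "\<dots> = id" by (metis funpow_mult qt_funpow_4 id_funpow)
    finally have "act (qt i \<alpha> ^^ (3 * k)) (act (qt i \<alpha> ^^ k) f) = f"
      by (metis act_comp act_id bij)
    then show ?thesis using funpow_step[OF that] by metis
  qed
  then have "\<Psi> (act T f) \<longleftrightarrow> \<Psi> f" if "T \<in> basic_twists" for T f
    using basic_twistsE[OF that] funpow_step by metis
  moreover have "twist_closed K"
    unfolding twist_closed_def using basic_twistsE funpow_closed by metis
  ultimately show ?thesis
    unfolding local_invariant_def using \<open>finite K\<close> cong by metis
qed

lemma local_invariant_card: "local_invariant (cluster c) (\<lambda>f. card {d \<in> cluster c. f d = v} = n)"
proof (rule local_invariantI[OF finite_cluster qt_in_cluster_iff])
  fix i \<alpha> and f :: "'a config"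
  have "{d \<in> cluster c. act (qt i \<alpha>) f d = v} = qt i \<alpha> ` {d \<in> cluster c. f d = v}" (is "?A = _ ` ?B")
  proof (intro equalityI subsetI)
    fix d assume "d \<in> ?A"
    then have "inv (qt i \<alpha>) d \<in> ?B" "d = qt i \<alpha> (inv (qt i \<alpha>) d)"
      by (simp_all add: act_def) (metis qt_in_cluster_iff qt_inv_qt(1))
    then show "d \<in> qt i \<alpha> ` ?B" by (rule image_eqI[rotated])
  qed (auto simp: act_def)
  then have "card ?A = card ?B"
    using card_image[OF inj_on_subset[OF bij_is_inj[OF bij_qt] subset_UNIV]] by simp
  then show "card ?B = n \<Longrightarrow> card ?A = n" by simp
next
  fix f f' :: "'a config" assume "\<And>d. d \<in> cluster c \<Longrightarrow> f d = f' d"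
  then have "{d \<in> cluster c. f d = v} = {d \<in> cluster c. f' d = v}" by auto
  then show "card {d \<in> cluster c. f d = v} = n \<Longrightarrow> card {d \<in> cluster c. f' d = v} = n" by simp
qed

lemma crd_eqI: "(\<And>i. i \<in> {0, 1, 2} \<Longrightarrow> crd p i = crd q i) \<Longrightarrow> p = q"
  by (cases p; cases q) (fastforce simp: crd_def)

lemma crd_rot:
  assumes "i \<in> {0, 1, 2}"
  shows "crd (rot \<pi> \<epsilon> p) i = (if \<epsilon> i then neg (crd p (\<pi> i)) else crd p (\<pi> i))"
  using assms by (cases p) (auto simp: crd_def rot_def)

lemma rot_rot:
  assumes "\<pi> permutes {0, 1, 2}"
  shows "rot \<pi> \<epsilon> (rot \<pi>' \<epsilon>' p) = rot (\<pi>' \<circ> \<pi>) (\<lambda>i. \<epsilon> i \<noteq> \<epsilon>' (\<pi> i)) p"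
proof (rule crd_eqI)
  fix i :: nat assume i: "i \<in> {0, 1, 2}"
  then have \<pi>i: "\<pi> i \<in> {0, 1, 2}" using permutes_in_image[OF assms, of i] by (simp only:)
  show "crd (rot \<pi> \<epsilon> (rot \<pi>' \<epsilon>' p)) i = crd (rot (\<pi>' \<circ> \<pi>) (\<lambda>i. \<epsilon> i \<noteq> \<epsilon>' (\<pi> i)) p) i"
    unfolding crd_rot[OF i] crd_rot[OF \<pi>i] comp_apply by (cases "\<epsilon> i"; cases "\<epsilon>' (\<pi> i)") simp_all
qed

definition rot_det :: "(nat \<Rightarrow> nat) \<Rightarrow> (nat \<Rightarrow> bool) \<Rightarrow> int" where
  "rot_det \<pi> \<epsilon> = sign \<pi> * (\<Prod>i\<in>{0, 1, 2}. if \<epsilon> i then -1 else 1)"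

lemma is_rotation_iff: "is_rotation \<pi> \<epsilon> \<longleftrightarrow> \<pi> permutes {0, 1, 2} \<and> rot_det \<pi> \<epsilon> = 1"
  unfolding is_rotation_def rot_det_def ..

lemma rot_det_comp:
  assumes "\<pi> permutes {0, 1, 2}" "\<pi>' permutes {0, 1, 2}"
  shows "rot_det (\<pi>' \<circ> \<pi>) (\<lambda>i. \<epsilon> i \<noteq> \<epsilon>' (\<pi> i)) = rot_det \<pi> \<epsilon> * rot_det \<pi>' \<epsilon>'"
proof -
  define s :: "(nat \<Rightarrow> bool) \<Rightarrow> nat \<Rightarrow> int" where "s \<epsilon> i = (if \<epsilon> i then -1 else 1)" for \<epsilon> i
  have "prod (s (\<lambda>i. \<epsilon> i \<noteq> \<epsilon>' (\<pi> i))) A = prod (s \<epsilon>) A * prod (\<lambda>i. s \<epsilon>' (\<pi> i)) A" for A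
    unfolding prod.distrib[symmetric] by (rule prod.cong) (auto simp: s_def)
  moreover have "prod (\<lambda>i. s \<epsilon>' (\<pi> i)) {0, 1, 2} = prod (s \<epsilon>') {0, 1, 2}"
    using prod.permute[OF assms(1), of "s \<epsilon>'"] by (simp only: comp_def)
  moreover have "sign (\<pi>' \<circ> \<pi>) = sign \<pi>' * sign \<pi>"
    using assms by (intro sign_compose) (auto intro: permutes_imp_permutation[rotated])
  moreover have "rot_det \<pi> \<epsilon> = sign \<pi> * prod (s \<epsilon>) {0, 1, 2}" for \<pi> \<epsilon>
    unfolding rot_det_def s_def[abs_def] ..
  ultimately show ?thesis by (simp only: mult_ac)
qed

text \<open>Inverse quarter turns are encoded here, because a twist acts on configurations through its inverse.\<close>

fun turn_perm :: "axis \<Rightarrow> nat \<Rightarrow> nat" where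
  "turn_perm AX = transpose 1 2"
| "turn_perm AY = transpose 0 2"
| "turn_perm AZ = transpose 0 1"

fun turn_sign :: "axis \<Rightarrow> nat \<Rightarrow> bool" where
  "turn_sign AX = (\<lambda>k. k = 2)"
| "turn_sign AY = (\<lambda>k. k = 0)"
| "turn_sign AZ = (\<lambda>k. k = 1)"

lemma is_rotation_turn: "is_rotation (turn_perm i) (turn_sign i)"
  unfolding is_rotation_def by (cases i) (auto simp: sign_swap_id intro: permutes_swap_id)

lemma is_rotation_turn_iff:
  assumes "\<pi> permutes {0, 1, 2}"
  shows "is_rotation (turn_perm i \<circ> \<pi>) (\<lambda>k. \<epsilon> k \<noteq> turn_sign i (\<pi> k)) \<longleftrightarrow> is_rotation \<pi> \<epsilon>"
proof -
  have turn: "turn_perm i permutes {0, 1, 2}" "rot_det (turn_perm i) (turn_sign i) = 1"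
    using is_rotation_turn[of i] by (simp_all only: is_rotation_iff)
  show ?thesis
    unfolding is_rotation_iff rot_det_comp[OF assms turn(1)] turn(2)
    using permutes_compose[OF assms turn(1)] assms by simp
qed

lemma Rep_inv_qt_center:
  assumes "center_cell c"
  shows "Rep_cell (inv (qt i \<alpha>) c) =
    (if \<alpha> = Fin Zero then rot (turn_perm i) (turn_sign i) (Rep_cell c) else Rep_cell c)"
proof (cases c)
  case (face_cell col u v)
  then show ?thesis
    using assms by (cases col; cases i)
      (auto simp: inv_qt eval_nat_numeral rot_def crd_def Let_def Transposition.transpose_def)
qed

lemma center_cell_qt [simp]: "center_cell (qt i \<alpha> c) \<longleftrightarrow> center_cell c"
  using center_cell_cluster[OF qt_in_cluster] .

lemma center_cell_inv_qt [simp]: "center_cell (inv (qt i \<alpha>) c) \<longleftrightarrow> center_cell c"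
  by (metis center_cell_qt qt_inv_qt(1))

definition center_rotated :: "(nat \<Rightarrow> nat) \<Rightarrow> (nat \<Rightarrow> bool) \<Rightarrow> 'l config \<Rightarrow> bool" where
  "center_rotated \<pi> \<epsilon> f \<longleftrightarrow> (\<forall>c. center_cell c \<longrightarrow> f c = solved_pt (rot \<pi> \<epsilon> (Rep_cell c)))"

lemma center_rotated_turn_iff:
  fixes f :: "'l config"
  assumes "\<pi> permutes {0, 1, 2}"
  shows "center_rotated (turn_perm i \<circ> \<pi>) (\<lambda>k. \<epsilon> k \<noteq> turn_sign i (\<pi> k)) (act (qt i (Fin Zero)) f)
    \<longleftrightarrow> center_rotated \<pi> \<epsilon> f"
proof -
  let ?T = "qt i (Fin Zero) :: 'l cell \<Rightarrow> 'l cell"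
  have "center_rotated (turn_perm i \<circ> \<pi>) (\<lambda>k. \<epsilon> k \<noteq> turn_sign i (\<pi> k)) (act ?T f) \<longleftrightarrow>
    (\<forall>c. center_cell c \<longrightarrow> f (inv ?T c) = solved_pt (rot \<pi> \<epsilon> (Rep_cell (inv ?T c))))"
    unfolding center_rotated_def act_def rot_rot[OF assms, symmetric] by (simp add: Rep_inv_qt_center)
  also have "\<dots> \<longleftrightarrow> center_rotated \<pi> \<epsilon> f"
    unfolding center_rotated_def
  proof (intro iffI allI impI)
    fix c :: "'l cell"
    assume turned: "\<forall>c. center_cell c \<longrightarrow> f (inv ?T c) = solved_pt (rot \<pi> \<epsilon> (Rep_cell (inv ?T c)))"
      and "center_cell c"
    then show "f c = solved_pt (rot \<pi> \<epsilon> (Rep_cell c))"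
      using spec[OF turned, of "?T c"] unfolding qt_inv_qt(2) center_cell_qt by blast
  qed simp
  finally show ?thesis .
qed

definition center_standard :: "'l config \<Rightarrow> bool" where
  "center_standard f \<longleftrightarrow> (\<exists>\<pi> \<epsilon>. is_rotation \<pi> \<epsilon> \<and> center_rotated \<pi> \<epsilon> f)"

lemma center_standard_qt:
  assumes "center_standard f"
  shows "center_standard (act (qt i \<alpha>) f)"
proof (cases "\<alpha> = Fin Zero")
  case True
  obtain \<pi> \<epsilon> where rot: "is_rotation \<pi> \<epsilon>" "center_rotated \<pi> \<epsilon> f"
    using assms unfolding center_standard_def by blast
  then have "\<pi> permutes {0, 1, 2}" by (simp add: is_rotation_def)
  then show ?thesis
    unfolding True center_standard_def
    using rot is_rotation_turn_iff[THEN iffD2] center_rotated_turn_iff[THEN iffD2] by blast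
next
  case False
  have "inv (qt i \<alpha>) c = c" if "center_cell c" for c
    using Rep_inv_qt_center[OF that, of i \<alpha>] False by (simp add: Rep_cell_inject)
  then show ?thesis
    using assms unfolding center_standard_def center_rotated_def act_def by simp
qed

lemma finite_center_cells: "finite {c :: 'l cell. center_cell c}"
proof -
  have "{c :: 'l cell. center_cell c} \<subseteq> range (\<lambda>col. face_cell col (Zero, Zero))"
  proof
    show "c \<in> range (\<lambda>col. face_cell col (Zero, Zero))" if "c \<in> {c. center_cell c}" for c :: "'l cell"
      using that by (cases c) auto
  qed
  then show ?thesis by (rule finite_subset) simp
qed

lemma local_invariant_center: "local_invariant {c. center_cell c} center_standard"
proof (rule local_invariantI[OF finite_center_cells])
  fix f f' :: "'a config" assume "\<And>c. c \<in> {c. center_cell c} \<Longrightarrow> f c = f' c"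
  then show "center_standard f \<Longrightarrow> center_standard f'"
    unfolding center_standard_def center_rotated_def by simp
qed (simp_all add: center_standard_qt)

lemma standard_iff: "standard f \<longleftrightarrow> legal f \<and>
   (\<forall>c col. \<not> center_cell c \<longrightarrow> card {d \<in> cluster c. f d = Some col} = 4) \<and> center_standard f"
  unfolding standard_def center_standard_def center_rotated_def noncenter_clusters_def by blast

lemma standard_cong_local_invariants:
  assumes "legal f" "legal g" and inv: "\<And>K \<Psi>. local_invariant K \<Psi> \<Longrightarrow> \<Psi> f \<longleftrightarrow> \<Psi> g"
  shows "standard f \<longleftrightarrow> standard g"
  using assms(1,2) inv[OF local_invariant_card] inv[OF local_invariant_center]
  unfolding standard_iff by simp

lemma accessible_standard_iff:
  assumes "accessible TYPE('o) f g" "legal f" "legal g"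
  shows "standard f \<longleftrightarrow> standard g"
proof -
  obtain r :: "'o rel" where "accessible_via r f g" using assms(1) by (auto simp: accessible_def)
  then show ?thesis
    using assms(2,3) local_invariant_accessible[of r f g]
    by (intro standard_cong_local_invariants) (auto simp: legal_def)
qed

lemma standard_f_solved: "standard (f_solved :: 'l config)"
proof -
  have "is_rotation id (\<lambda>i. False)" by (simp add: is_rotation_def permutes_id)
  moreover have "rot id (\<lambda>i. False) p = p" for p :: "'l pt"
    by (cases p) (simp add: rot_def crd_def)
  then have "center_rotated id (\<lambda>i. False) (f_solved :: 'l config)"
    by (simp add: center_rotated_def f_solved_def)
  ultimately show ?thesis
    unfolding standard_iff center_standard_def using legal_f_solved card_f_solved_cluster by blast
qed

lemma standard_cards:
  assumes "standard f" "standard g" "\<not> center_cell c"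
  shows "card {d \<in> cluster c. f d = v} = card {d \<in> cluster c. g d = v}"
proof (cases v)
  case None
  then have empty: "{d \<in> cluster c. h d = v} = {}" if "standard h" for h
    using that by (auto simp: standard_def legal_def)
  show ?thesis unfolding empty[OF assms(1)] empty[OF assms(2)] ..
next
  case (Some col)
  then show ?thesis using assms unfolding standard_iff by simp
qed

lemma standard_repeated_colour:
  assumes "standard g" "\<not> center_cell c"
  shows "\<exists>z\<in>cluster c. \<exists>w\<in>cluster c. z \<noteq> w \<and> g z = g w"
proof -
  let ?R = "{d \<in> cluster c. g d = Some Red}"
  have "card ?R = 4" using assms unfolding standard_iff by blast
  then have "\<not> card ?R \<le> Suc 0" by simp
  moreover have "finite ?R" using finite_cluster[of c] by simp
  ultimately obtain z w where "z \<in> ?R" "w \<in> ?R" "z \<noteq> w" using card_le_Suc0_iff_eq by blast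
  then have "z \<in> cluster c" "w \<in> cluster c" "g z = g w" by simp_all
  with \<open>z \<noteq> w\<close> show ?thesis by blast
qed

definition center_turns :: "('l cell \<Rightarrow> 'l cell) set" where
  "center_turns = (\<Union>i. {qt i (Fin Zero), inv (qt i (Fin Zero))})"

lemma comp_closure_center_turns:
  assumes "s \<in> comp_closure center_turns"
  shows "bij s" "inv s \<in> comp_closure center_turns" "center_cell (s c) \<longleftrightarrow> center_cell c"
proof -
  have "bij t \<and> inv t \<in> comp_closure center_turns" if "t \<in> center_turns" for t :: "'a cell \<Rightarrow> 'a cell"
  proof
    show "bij t" using that by (auto simp: center_turns_def bij_imp_bij_inv)
    have "inv t \<in> center_turns" using that by (auto simp: center_turns_def inv_inv_eq)
    then show "inv t \<in> comp_closure center_turns" by (rule comp_closure_base)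
  qed
  then show "bij s" "inv s \<in> comp_closure center_turns" using comp_closure_inv[OF assms] by blast+
  show "center_cell (s c) \<longleftrightarrow> center_cell c"
    using assms by (induction rule: comp_closure_induct) (auto simp: center_turns_def)
qed

lemma center_rotated_id_half_turn_iff:
  fixes f :: "'l config"
  defines "T \<equiv> \<lambda>i. qt i (Fin Zero) :: 'l cell \<Rightarrow> 'l cell"
  shows "center_rotated id (\<lambda>k. \<epsilon> k \<noteq> (turn_sign i k \<noteq> turn_sign i (turn_perm i k))) (act (T i \<circ> T i) f)
    \<longleftrightarrow> center_rotated id \<epsilon> f"
proof -
  have "turn_perm i \<circ> turn_perm i = id" by (cases i) simp_all
  moreover have "turn_perm i permutes {0, 1, 2}"
    using is_rotation_turn by (simp only: is_rotation_iff)
  moreover have "((\<epsilon> k \<noteq> turn_sign i k) \<noteq> turn_sign i (turn_perm i k)) \<longleftrightarrow>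
    (\<epsilon> k \<noteq> (turn_sign i k \<noteq> turn_sign i (turn_perm i k)))" for k by blast
  ultimately show ?thesis
    using center_rotated_turn_iff[of "turn_perm i" i "\<lambda>k. \<epsilon> k \<noteq> turn_sign i k" "act (T i) f"]
      center_rotated_turn_iff[OF permutes_id, of i \<epsilon> f]
    by (simp add: T_def act_comp)
qed

lemma center_rotated_id_solved:
  assumes "center_rotated id \<epsilon> f" "\<And>k. k \<in> {0, 1, 2} \<Longrightarrow> \<not> \<epsilon> k" "center_cell c"
  shows "f c = f_solved c"
proof -
  have "rot id \<epsilon> (Rep_cell c) = Rep_cell c"
    using assms(2) by (intro crd_eqI) (simp add: crd_rot del: insert_iff)
  then show ?thesis using assms(1,3) by (simp add: center_rotated_def f_solved_def)
qed

lemma unscramble_center_half_turn: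
  fixes f :: "'l config"
  assumes "is_rotation id \<epsilon>" "center_rotated id \<epsilon> f"
  shows "\<exists>s\<in>comp_closure center_turns. \<forall>c. center_cell c \<longrightarrow> act s f c = f_solved c"
proof -
  have "(\<epsilon> 0 \<longleftrightarrow> \<epsilon> 1) \<longleftrightarrow> \<not> \<epsilon> 2"
    using assms(1) by (auto simp: is_rotation_iff rot_det_def sign_id split: if_splits)
  then consider (identity) "\<not> \<epsilon> 0 \<and> \<not> \<epsilon> 1 \<and> \<not> \<epsilon> 2"
    | (half_turn) i where "\<forall>k\<in>{0, 1, 2}. \<epsilon> k = (turn_sign i k \<noteq> turn_sign i (turn_perm i k))"
    using that(2)[of AX] that(2)[of AY] that(2)[of AZ] by (auto simp: Transposition.transpose_def)
  then show ?thesis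
  proof cases
    case identity
    then have "f c = f_solved c" if "center_cell c" for c
      using center_rotated_id_solved[OF assms(2) _ that] by auto
    then show ?thesis by (intro bexI[of _ id]) simp_all
  next
    case (half_turn i)
    let ?T = "qt i (Fin Zero) :: 'l cell \<Rightarrow> 'l cell"
    have "?T \<circ> ?T \<in> comp_closure center_turns"
      by (intro comp_closure_comp comp_closure_base) (auto simp: center_turns_def)
    moreover have "act (?T \<circ> ?T) f c = f_solved c" if "center_cell c" for c
      using center_rotated_id_solved[OF center_rotated_id_half_turn_iff[THEN iffD2, OF assms(2)] _ that]
        half_turn by blast
    ultimately show ?thesis by blast
  qed
qed

lemma unscramble_center:
  fixes f :: "'l config"
  assumes "is_rotation \<pi> \<epsilon>" "center_rotated \<pi> \<epsilon> f"
  shows "\<exists>s\<in>comp_closure center_turns. \<forall>c. center_cell c \<longrightarrow> act s f c = f_solved c"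
proof -
  have "\<pi> permutes {0, 1, 2}" "finite {0, 1, 2 :: nat}" using assms(1) by (simp_all add: is_rotation_def)
  from this assms show ?thesis
  proof (induction arbitrary: \<epsilon> f rule: permutes_induct)
    case id
    then show ?case using unscramble_center_half_turn by blast
  next
    case (swap a b \<pi>)
    obtain i where i: "turn_perm i = transpose a b"
      using swap(1-3) by (auto simp: transpose_commute intro: that[of AX] that[of AY] that[of AZ])
    define \<delta> where "\<delta> k = (\<epsilon> k \<noteq> turn_sign i (\<pi> k))" for k
    have \<epsilon>: "\<epsilon> = (\<lambda>k. \<delta> k \<noteq> turn_sign i (\<pi> k))" by (auto simp: \<delta>_def)
    let ?T = "qt i (Fin Zero) :: 'l cell \<Rightarrow> 'l cell"
    define h where "h = act (inv ?T) f"
    have f: "f = act ?T h" by (simp add: h_def act_def inv_inv_eq)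
    have "is_rotation \<pi> \<delta>" "center_rotated \<pi> \<delta> h"
      using swap.prems is_rotation_turn_iff[OF \<open>\<pi> permutes {0, 1, 2}\<close>]
        center_rotated_turn_iff[OF \<open>\<pi> permutes {0, 1, 2}\<close>]
      unfolding \<epsilon> f i[symmetric] by blast+
    then obtain s where s: "s \<in> comp_closure center_turns" "\<forall>c. center_cell c \<longrightarrow> act s h c = f_solved c"
      using swap.IH by blast
    then have "act (s \<circ> inv ?T) f = act s h"
      unfolding h_def using comp_closure_center_turns by (intro act_comp) (blast, simp add: bij_imp_bij_inv)
    moreover have "s \<circ> inv ?T \<in> comp_closure center_turns"
      by (intro comp_closure_comp[OF s(1)] comp_closure_base) (auto simp: center_turns_def)
    ultimately show ?case using s(2) by metis
  qed
qed

lemma center_reachable: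
  assumes "center_standard f" "center_standard g"
  shows "\<exists>s\<in>comp_closure center_turns. \<forall>c. center_cell c \<longrightarrow> act s f c = g c"
proof -
  obtain s t where s: "s \<in> comp_closure center_turns" "\<And>c. center_cell c \<Longrightarrow> act s f c = f_solved c"
    and t: "t \<in> comp_closure center_turns" "\<And>c. center_cell c \<Longrightarrow> act t g c = f_solved c"
    using assms unscramble_center unfolding center_standard_def by metis
  have bij: "bij s" "bij t" using comp_closure_center_turns(1) s(1) t(1) by blast+
  have "act (inv t \<circ> s) f c = g c" if "center_cell c" for c
  proof -
    have "act (inv t \<circ> s) f c = act s f (t c)"
      using bij by (simp add: act_comp bij_imp_bij_inv) (simp add: act_def inv_inv_eq)
    also have "\<dots> = act t g (t c)"
      using s(2) t(2) comp_closure_center_turns(3)[OF t(1)] that by simp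
    also have "\<dots> = g c" using bij(2) by (rule act_apply)
    finally show ?thesis .
  qed
  moreover have "inv t \<circ> s \<in> comp_closure center_turns"
    using comp_closure_center_turns(2)[OF t(1)] s(1) by (rule comp_closure_comp)
  ultimately show ?thesis by blast
qed

section \<open>Segments of length omega\<close>

definition omega_run :: "'l cell set \<Rightarrow> (nat \<Rightarrow> 'l cell \<Rightarrow> 'l cell) \<Rightarrow> (nat \<Rightarrow> 'l config) \<Rightarrow>
    'l config \<Rightarrow> 'l config \<Rightarrow> bool" where
  "omega_run D \<sigma> F f f' \<longleftrightarrow> (\<forall>k. \<sigma> k \<in> basic_twists) \<and> F 0 = f \<and> (\<forall>k. F (Suc k) = act (\<sigma> k) (F k)) \<and>
     (\<forall>c. \<forall>\<^sub>F k in sequentially. F k c = f' c) \<and> (\<forall>c\<in>D. \<forall>k. F k c = f c)"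

definition omega_segment :: "'l cell set \<Rightarrow> 'l config \<Rightarrow> 'l config \<Rightarrow> bool" where
  "omega_segment D f f' \<longleftrightarrow> (\<exists>\<sigma> F. omega_run D \<sigma> F f f')"

lemma omega_segment_const:
  assumes "omega_segment D f f'" "c \<in> D"
  shows "f' c = f c"
proof -
  obtain F :: "nat \<Rightarrow> 'a config" where "\<forall>\<^sub>F k in sequentially. F k c = f' c" "\<forall>k. F k c = f c"
    using assms unfolding omega_segment_def omega_run_def by blast
  then show ?thesis by (auto dest: eventually_happens)
qed

lemma omega_segment_local_invariant:
  assumes "omega_segment D f f'" and inv: "local_invariant K \<Psi>"
  shows "\<Psi> f' \<longleftrightarrow> \<Psi> f"
proof -
  obtain \<sigma> F where F: "\<And>k. \<sigma> k \<in> basic_twists" "F 0 = f" "\<And>k. F (Suc k) = act (\<sigma> k) (F k)"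
    "\<And>c. \<forall>\<^sub>F k in sequentially. F k c = f' c"
    using assms(1) unfolding omega_segment_def omega_run_def by blast
  have "\<Psi> (F k) \<longleftrightarrow> \<Psi> f" for k
    by (induction k) (simp_all add: F local_invariant_act[OF inv])
  moreover have "\<forall>\<^sub>F k in sequentially. \<forall>c\<in>K. F k c = f' c"
    using local_invariant_finite[OF inv] F(4) by (simp add: eventually_ball_finite)
  then obtain k where "\<forall>c\<in>K. F k c = f' c" by (auto dest: eventually_happens)
  then have "\<Psi> (F k) \<longleftrightarrow> \<Psi> f'" by (intro local_invariant_cong[OF inv]) blast
  ultimately show ?thesis by blast
qed

lemma omega_segment_legal:
  assumes "omega_segment D f f'" "legal f"
  shows "legal f'"
proof -
  obtain \<sigma> F where F: "F 0 = f" "\<And>k. F (Suc k) = act (\<sigma> k) (F k)"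
    "\<And>c. \<forall>\<^sub>F k in sequentially. F k c = f' c"
    using assms(1) unfolding omega_segment_def omega_run_def by blast
  have "F k c \<noteq> None" for k c
    using F(1,2) assms(2) by (induction k arbitrary: c) (auto simp: legal_def act_def)
  then have "f' c \<noteq> None" for c
    using eventually_happens[OF F(3)[of c]] by (metis sequentially_bot)
  then show ?thesis by (simp add: legal_def)
qed

lemma omega_segment_standard:
  assumes "omega_segment D f f'" "standard f"
  shows "standard f'"
proof -
  have "legal f" using assms(2) by (simp add: standard_def)
  then show ?thesis
    using standard_cong_local_invariants[OF omega_segment_legal[OF assms(1)]]
      omega_segment_local_invariant[OF assms(1)] assms(2) by blast
qed

lemma omega_segment_prepend:
  assumes T: "T \<in> basic_twists" and D: "\<And>c. c \<in> D \<Longrightarrow> act T f c = f c"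
    and seg: "omega_segment D (act T f) f'"
  shows "omega_segment D f f'"
proof -
  obtain \<sigma> F where F: "\<And>k. \<sigma> k \<in> basic_twists" "F 0 = act T f" "\<And>k. F (Suc k) = act (\<sigma> k) (F k)"
     "\<And>c. \<forall>\<^sub>F k in sequentially. F k c = f' c" "\<And>c k. c \<in> D \<Longrightarrow> F k c = act T f c"
    using seg unfolding omega_segment_def omega_run_def by blast
  have "\<forall>k. case_nat T \<sigma> k \<in> basic_twists" using T F(1) by (simp split: nat.split)
  moreover have "\<forall>k. case_nat f F (Suc k) = act (case_nat T \<sigma> k) (case_nat f F k)"
    using F(2,3) by (simp split: nat.split)
  moreover have "\<forall>\<^sub>F k in sequentially. case_nat f F k c = f' c" for c
    using F(4) by (subst eventually_sequentially_Suc[symmetric]) simp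
  moreover have "\<forall>c\<in>D. \<forall>k. case_nat f F k c = f c" using F(5) D by (simp split: nat.split)
  ultimately show ?thesis
    unfolding omega_segment_def omega_run_def by (intro exI[of _ "case_nat T \<sigma>"] exI[of _ "case_nat f F"]) simp
qed

lemma omega_segment_pairs:
  assumes S: "\<And>k. S k \<in> basic_twists" "\<And>k. S' k \<in> basic_twists"
    and G: "G 0 = f" "\<And>k. G (Suc k) = act (S' k \<circ> S k) (G k)"
    and lim: "\<And>c. \<exists>N. \<forall>k\<ge>N. G k c = f' c \<and> act (S k) (G k) c = f' c"
    and const: "\<And>c k. c \<in> D \<Longrightarrow> G k c = f c \<and> act (S k) (G k) c = f c"
  shows "omega_segment D f f'"
proof -
  define \<sigma> where "\<sigma> j = (if even j then S (j div 2) else S' (j div 2))" for j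
  define F where "F j = (if even j then G (j div 2) else act (S (j div 2)) (G (j div 2)))" for j
  have "F (Suc j) = act (\<sigma> j) (F j)" for j
  proof (cases "even j")
    case False
    have "bij (S (j div 2))" "bij (S' (j div 2))" using S by (simp_all add: bij_basic_twist)
    then show ?thesis using False by (simp add: F_def \<sigma>_def G(2) act_comp)
  qed (simp add: F_def \<sigma>_def)
  moreover have "\<forall>\<^sub>F j in sequentially. F j c = f' c" for c
  proof -
    obtain N where "\<forall>k\<ge>N. G k c = f' c \<and> act (S k) (G k) c = f' c" using lim by blast
    then show ?thesis by (intro eventually_sequentiallyI[of "2 * N"]) (simp add: F_def)
  qed
  moreover have "F 0 = f" "\<sigma> j \<in> basic_twists" "c \<in> D \<Longrightarrow> F j c = f c" for j c
    using S G(1) const by (simp_all add: F_def \<sigma>_def)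
  ultimately show ?thesis unfolding omega_segment_def omega_run_def by blast
qed

definition layer_preserving :: "('l \<Rightarrow> nat) \<Rightarrow> ('l cell \<Rightarrow> 'l cell) \<Rightarrow> bool" where
  "layer_preserving e s \<longleftrightarrow> bij s \<and> (\<forall>c. layers e (s c) = layers e c)"

lemma layer_preserving_id [simp]: "layer_preserving e id"
  by (simp add: layer_preserving_def)

lemma layer_preserving_comp: "layer_preserving e s \<Longrightarrow> layer_preserving e t \<Longrightarrow> layer_preserving e (s \<circ> t)"
  by (simp add: layer_preserving_def bij_comp)

lemma layer_preserving_inv:
  assumes "layer_preserving e s"
  shows "layer_preserving e (inv s)" "layers e (inv s c) = layers e c"
proof -
  have "bij s" using assms by (simp add: layer_preserving_def)
  then have "layers e (inv s c) = layers e c" for c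
    using assms unfolding layer_preserving_def by (metis bij_inv_eq_iff)
  with \<open>bij s\<close> show "layer_preserving e (inv s)" "layers e (inv s c) = layers e c"
    by (simp_all add: layer_preserving_def bij_imp_bij_inv)
qed

lemma layer_preserving_qt [simp]: "layer_preserving e (qt i \<alpha>)" "layer_preserving e (inv (qt i \<alpha>))"
  by (simp_all add: layer_preserving_def bij_imp_bij_inv)

lemma lo_hi_layer_inv:
  assumes "layer_preserving e s"
  shows "lo_layer e (inv s c) = lo_layer e c" "hi_layer e (inv s c) = hi_layer e c"
  by (simp_all add: lo_layer_def hi_layer_def layer_preserving_inv(2)[OF assms])

text \<open>All powers, the identity included, are needed: a layer may have to be left alone.\<close>

definition slice_powers :: "('l \<Rightarrow> nat) \<Rightarrow> nat \<Rightarrow> ('l cell \<Rightarrow> 'l cell) set" where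
  "slice_powers e n = {qt i (Fin s) ^^ k | i s k. layer e s = n}"

lemma qt_in_slice_powers: "layer e s = n \<Longrightarrow> qt i (Fin s) \<in> slice_powers e n"
proof -
  have "qt i (Fin s) = qt i (Fin s) ^^ 1" by simp
  then show "layer e s = n \<Longrightarrow> qt i (Fin s) \<in> slice_powers e n" unfolding slice_powers_def by blast
qed

lemma id_in_slice_powers:
  assumes "surj e"
  shows "id \<in> slice_powers e n"
proof -
  have "\<exists>s. layer e s = n"
    using assms by (cases n) (auto intro: exI[of _ Zero], metis layer.simps(2) surjD)
  then obtain s where "layer e s = n" by blast
  moreover have "id = qt AX (Fin s) ^^ 0" by simp
  ultimately show ?thesis unfolding slice_powers_def by blast
qed

lemma inv_slice_powers:
  assumes "T \<in> slice_powers e n"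
  shows "inv T \<in> slice_powers e n"
proof -
  obtain i s k where T: "T = qt i (Fin s) ^^ k" "layer e s = n"
    using assms unfolding slice_powers_def by blast
  have "inv T = inv (qt i (Fin s)) ^^ k" unfolding T(1) by (simp add: inv_fn)
  also have "\<dots> = qt i (Fin s) ^^ (3 * k)" by (simp add: inv_qt funpow_mult)
  finally show ?thesis unfolding slice_powers_def using T(2) by blast
qed

lemma layer_preserving_slice_power:
  assumes "T \<in> slice_powers e n"
  shows "layer_preserving e T"
proof -
  obtain i s k where "T = qt i (Fin s) ^^ k" using assms unfolding slice_powers_def by blast
  then show ?thesis by (induction k arbitrary: T) (simp_all add: layer_preserving_comp)
qed

lemma slice_power_fixed:
  assumes "T \<in> slice_powers e n" "n \<notin> layers e c"
  shows "act T f c = f c"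
proof -
  obtain i s k where T: "T = qt i (Fin s) ^^ k" "layer e s = n"
    using assms(1) unfolding slice_powers_def by blast
  have "qt i (Fin s) c = c" using assms(2) unfolding T(2)[symmetric] by (rule qt_fixed_layer)
  then have "(qt i (Fin s) ^^ k) c = c" by (induction k) simp_all
  moreover have "bij T" using layer_preserving_slice_power[OF assms(1)] by (simp add: layer_preserving_def)
  ultimately show ?thesis using act_apply[of T f c] T(1) by simp
qed

lemma slice_power_split:
  assumes "T \<in> slice_powers e n"
  shows "\<exists>S S'. S \<in> slice_powers e n \<inter> basic_twists \<and> S' \<in> slice_powers e n \<inter> basic_twists \<and> T = S' \<circ> S"
proof -
  obtain i s k where T: "T = qt i (Fin s) ^^ k" "layer e s = n"
    using assms unfolding slice_powers_def by blast
  obtain a b where ab: "a mod 4 \<noteq> 0" "b mod 4 \<noteq> 0" "b + a = k + (4 :: nat)"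
  proof (cases "k mod 4 = 1")
    case True
    then have "(k + 2) mod 4 \<noteq> 0" by presburger
    then show thesis using that[of 2 "k + 2"] by simp
  next
    case False
    then have "(k + 3) mod 4 \<noteq> 0" by presburger
    then show thesis using that[of 1 "k + 3"] by simp
  qed
  have "qt i (Fin s) ^^ b \<circ> qt i (Fin s) ^^ a = qt i (Fin s) ^^ (k + 4)"
    by (simp add: ab(3) flip: funpow_add)
  also have "\<dots> = T" unfolding T(1) funpow_add qt_funpow_4 by simp
  finally have "T = qt i (Fin s) ^^ b \<circ> qt i (Fin s) ^^ a" ..
  moreover have "qt i (Fin s) ^^ k \<in> slice_powers e n \<inter> basic_twists" if "k mod 4 \<noteq> 0" for k
    using funpow_qt_basic[OF that] T(2) unfolding slice_powers_def by blast
  ultimately show ?thesis using ab(1,2) by blast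
qed

lemma not_in_layers: "hi_layer e c < n \<Longrightarrow> n \<notin> layers e c"
  using layers_eq[of e c] lo_layer_le_hi_layer[of e c] by auto

lemma iterated_slices:
  assumes B: "\<And>n. m < n \<Longrightarrow> B n \<in> slice_powers e n"
    and G: "G 0 = f" "\<And>k. G (Suc k) = act (B (Suc (m + k))) (G k)" and "lo_layer e c \<le> m"
  shows "G k c = (if m < hi_layer e c \<and> hi_layer e c \<le> m + k then act (B (hi_layer e c)) f c else f c)"
  using assms(4)
proof (induction k arbitrary: c)
  case 0
  show ?case by (auto simp: G(1))
next
  case (Suc k)
  have slice: "B (Suc (m + k)) \<in> slice_powers e (Suc (m + k))" by (rule B) simp
  show ?case
  proof (cases "hi_layer e c = Suc (m + k)")
    case True
    note inv = lo_hi_layer_inv[OF layer_preserving_slice_power[OF slice], of c]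
    have "G (Suc k) c = G k (inv (B (Suc (m + k))) c)" by (simp add: G(2) act_def)
    also have "\<dots> = f (inv (B (Suc (m + k))) c)" using Suc.IH Suc.prems inv True by simp
    finally show ?thesis using True by (simp add: act_def)
  next
    case False
    then have "Suc (m + k) \<notin> layers e c" using layers_eq[of e c] Suc.prems by auto
    then have "G (Suc k) c = G k c" unfolding G(2) by (rule slice_power_fixed[OF slice])
    then show ?thesis using Suc.IH[OF Suc.prems] False by auto
  qed
qed

lemma omega_segment_layerwise:
  assumes B: "\<And>n. m < n \<Longrightarrow> B n \<in> slice_powers e n"
  shows "\<exists>f'. omega_segment {c. hi_layer e c < m} f f' \<and> (\<forall>c. lo_layer e c \<le> m \<longrightarrow>
    f' c = (if m < hi_layer e c then act (B (hi_layer e c)) f c else f c))"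
proof -
  obtain S S' where "\<forall>n>m. S n \<in> slice_powers e n \<inter> basic_twists
    \<and> S' n \<in> slice_powers e n \<inter> basic_twists \<and> B n = S' n \<circ> S n"
    using slice_power_split[OF B] by metis
  then have S: "\<And>n. m < n \<Longrightarrow> S n \<in> slice_powers e n" "\<And>n. m < n \<Longrightarrow> S n \<in> basic_twists"
    "\<And>n. m < n \<Longrightarrow> S' n \<in> basic_twists" "\<And>n. m < n \<Longrightarrow> B n = S' n \<circ> S n" by blast+
  define G where "G = rec_nat f (\<lambda>k. act (B (Suc (m + k))))"
  have G: "G 0 = f" "\<And>k. G (Suc k) = act (B (Suc (m + k))) (G k)" by (simp_all add: G_def)
  define f' where "f' c = G (hi_layer e c) c" for c
  have G_late: "G k c = f' c" if "hi_layer e c \<le> k" for k c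
    unfolding f'_def using that
  proof (induction rule: dec_induct)
    case (step k)
    have "act (B (Suc (m + k))) (G k) c = G k c"
      using step(1) by (intro slice_power_fixed[OF B] not_in_layers) simp_all
    then show ?case using step by (simp add: G(2))
  qed simp
  have G_value: "G k c = (if m < hi_layer e c \<and> hi_layer e c \<le> m + k then act (B (hi_layer e c)) f c else f c)"
    if "lo_layer e c \<le> m" for k c
    using B G that by (rule iterated_slices)
  have S_fixed: "act (S (Suc (m + k))) (G k) c = G k c" if "hi_layer e c \<le> m + k" for k c
    using that by (intro slice_power_fixed[OF S(1)] not_in_layers) simp_all
  have "omega_segment {c. hi_layer e c < m} f f'"
  proof (rule omega_segment_pairs[where S = "\<lambda>k. S (Suc (m + k))" and S' = "\<lambda>k. S' (Suc (m + k))" and G = G])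
    show "G (Suc k) = act (S' (Suc (m + k)) \<circ> S (Suc (m + k))) (G k)" for k
      using S(4) by (simp add: G(2))
    show "\<exists>N. \<forall>k\<ge>N. G k c = f' c \<and> act (S (Suc (m + k))) (G k) c = f' c" for c
      using G_late S_fixed by (intro exI[of _ "hi_layer e c"]) simp
    show "G k c = f c \<and> act (S (Suc (m + k))) (G k) c = f c" if "c \<in> {c. hi_layer e c < m}" for k c
      using that G_value[of c k] S_fixed[of c k] lo_layer_le_hi_layer[of e c] by simp
  qed (simp_all add: G(1) S(2,3))
  moreover have "f' c = (if m < hi_layer e c then act (B (hi_layer e c)) f c else f c)"
    if "lo_layer e c \<le> m" for c
    unfolding f'_def using G_value[OF that] by simp
  ultimately show ?thesis by blast
qed

section \<open>Simultaneous moves in all clusters through one layer\<close>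

lemma commutator_id [simp]: "bij s \<Longrightarrow> commutator s id = id" "bij t \<Longrightarrow> commutator id t = id"
  by (simp_all add: commutator_def fun_eq_iff bij_is_surj surj_f_inv_f)

lemma inv_commutator:
  assumes "bij s" "bij t"
  shows "inv (commutator s t) = commutator t s"
  using assms by (simp add: commutator_def o_inv_distrib bij_comp bij_imp_bij_inv inv_inv_eq comp_assoc)

locale stage =
  fixes e :: "'l \<Rightarrow> nat" and g :: "'l config" and m :: nat
  assumes bij_e: "bij e" and standard_g: "standard g" and g_face: "\<And>T. T \<in> face_twists \<Longrightarrow> act T g = g"
begin

definition agrees :: "'l config \<Rightarrow> bool" where
  "agrees f \<longleftrightarrow> (\<forall>c. hi_layer e c < m \<longrightarrow> f c = g c)"

lemma agreesI: "(\<And>c. lo_layer e c < m \<Longrightarrow> f c = g c) \<Longrightarrow> agrees f"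
  unfolding agrees_def using lo_layer_le_hi_layer[of e] by (meson order.strict_trans1)

definition reaches :: "'l config \<Rightarrow> 'l config \<Rightarrow> bool" where
  "reaches = (omega_segment {c. hi_layer e c < m})\<^sup>+\<^sup>+"

lemma reaches_trans: "reaches f f' \<Longrightarrow> reaches f' f'' \<Longrightarrow> reaches f f''"
  unfolding reaches_def by (rule tranclp_trans)

lemma reaches_agrees: "reaches f f' \<Longrightarrow> agrees f \<Longrightarrow> agrees f'"
  unfolding reaches_def
  by (induction rule: tranclp_induct) (simp_all add: agrees_def omega_segment_const)

lemma reaches_standard: "reaches f f' \<Longrightarrow> standard f \<Longrightarrow> standard f'"
  unfolding reaches_def by (induction rule: tranclp_induct) (auto intro: omega_segment_standard)

text \<open>
  The family \<open>\<rho>\<close> prescribes one permutation for each \<open>n\<close>, to be applied to the cells with layers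
  \<open>k \<le> m\<close> and \<open>n\<close>; nothing is prescribed for cells both of whose layers exceed \<open>m\<close>.
\<close>

definition realizable :: "(nat \<Rightarrow> 'l cell \<Rightarrow> 'l cell) \<Rightarrow> bool" where
  "realizable \<rho> \<longleftrightarrow> (\<forall>n. layer_preserving e (\<rho> n)) \<and> (\<forall>f. agrees f \<longrightarrow>
     (\<exists>f'. reaches f f' \<and> (\<forall>c. lo_layer e c \<le> m \<longrightarrow> f' c = act (\<rho> (hi_layer e c)) f c)))"

lemma realizable_bij: "realizable \<rho> \<Longrightarrow> bij (\<rho> n)"
  by (simp add: realizable_def layer_preserving_def)

lemma realizable_comp:
  assumes "realizable \<rho>" "realizable \<tau>"
  shows "realizable (\<lambda>n. \<rho> n \<circ> \<tau> n)"
  unfolding realizable_def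
proof (intro conjI allI impI)
  show "layer_preserving e (\<rho> n \<circ> \<tau> n)" for n
    using assms by (simp add: realizable_def layer_preserving_comp)
  fix f assume f: "agrees f"
  obtain h where h: "reaches f h" "\<And>c. lo_layer e c \<le> m \<Longrightarrow> h c = act (\<tau> (hi_layer e c)) f c"
    using assms(2) f unfolding realizable_def by blast
  obtain h' where h': "reaches h h'" "\<And>c. lo_layer e c \<le> m \<Longrightarrow> h' c = act (\<rho> (hi_layer e c)) h c"
    using assms(1) reaches_agrees[OF h(1) f] unfolding realizable_def by blast
  have "h' c = act (\<rho> (hi_layer e c) \<circ> \<tau> (hi_layer e c)) f c" if "lo_layer e c \<le> m" for c
  proof -
    have "layer_preserving e (\<rho> (hi_layer e c))" using assms(1) by (simp add: realizable_def)
    note inv = lo_hi_layer_inv[OF this, of c]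
    have "h' c = h (inv (\<rho> (hi_layer e c)) c)" using h'(2) that by (simp add: act_def)
    also have "\<dots> = act (\<rho> (hi_layer e c)) (act (\<tau> (hi_layer e c)) f) c"
      using h(2) that inv by (simp add: act_def)
    finally show ?thesis using assms realizable_bij by (simp add: act_comp)
  qed
  with reaches_trans[OF h(1) h'(1)]
  show "\<exists>f'. reaches f f' \<and> (\<forall>c. lo_layer e c \<le> m \<longrightarrow> f' c = act (\<rho> (hi_layer e c) \<circ> \<tau> (hi_layer e c)) f c)"
    by blast
qed

lemma realizable_layerwise:
  assumes B: "\<And>n. m < n \<Longrightarrow> B n \<in> slice_powers e n" and idle: "\<And>n. n \<le> m \<Longrightarrow> B n = id"
  shows "realizable B"
  unfolding realizable_def
proof (intro conjI allI impI)
  show "layer_preserving e (B n)" for n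
    using layer_preserving_slice_power[OF B] idle by (cases "m < n") simp_all
  fix f
  obtain f' where f': "omega_segment {c. hi_layer e c < m} f f'" "\<And>c. lo_layer e c \<le> m \<Longrightarrow>
    f' c = (if m < hi_layer e c then act (B (hi_layer e c)) f c else f c)"
    using omega_segment_layerwise[OF B] by blast
  have "f' c = act (B (hi_layer e c)) f c" if "lo_layer e c \<le> m" for c
    using f'(2)[OF that] idle by simp
  then show "\<exists>f'. reaches f f' \<and> (\<forall>c. lo_layer e c \<le> m \<longrightarrow> f' c = act (B (hi_layer e c)) f c)"
    unfolding reaches_def using f'(1) by blast
qed

lemma realizable_id: "realizable (\<lambda>n. id)"
  using id_in_slice_powers[OF bij_is_surj[OF bij_e]] by (rule realizable_layerwise) simp

lemma realizable_piecewise: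
  assumes "finite A" "\<And>a. a \<in> A \<Longrightarrow> realizable (\<lambda>n. if \<kappa> n = a then \<rho> n else id)"
  shows "realizable (\<lambda>n. if \<kappa> n \<in> A then \<rho> n else id)"
  using assms
proof (induction A rule: finite_induct)
  case empty
  show ?case using realizable_id by (simp only: empty_iff if_False)
next
  case (insert a A)
  have "realizable (\<lambda>n. (if \<kappa> n = a then \<rho> n else id) \<circ> (if \<kappa> n \<in> A then \<rho> n else id))"
    using insert by (intro realizable_comp) simp_all
  moreover have "(if \<kappa> n = a then \<rho> n else id) \<circ> (if \<kappa> n \<in> A then \<rho> n else id) =
    (if \<kappa> n \<in> insert a A then \<rho> n else id)" for n
    using insert.hyps(2) by auto
  ultimately show ?case by simp
qed

lemma realizable_twist:
  assumes T: "T \<in> basic_twists" "layer_preserving e T"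
    and fixed: "\<And>f c. agrees f \<Longrightarrow> hi_layer e c < m \<Longrightarrow> act T f c = f c"
  shows "realizable (\<lambda>n. T)"
  unfolding realizable_def
proof (intro conjI allI impI)
  fix f assume f: "agrees f"
  have "\<exists>f'. omega_segment {c. hi_layer e c < m} (act T f) f' \<and>
    (\<forall>c. lo_layer e c \<le> m \<longrightarrow> f' c = act T f c)"
    using omega_segment_layerwise[OF id_in_slice_powers[OF bij_is_surj[OF bij_e]], of m "act T f"]
    unfolding act_id if_cancel .
  then obtain f' where f': "omega_segment {c. hi_layer e c < m} (act T f) f'"
    "\<And>c. lo_layer e c \<le> m \<Longrightarrow> f' c = act T f c"
    by blast
  have "omega_segment {c. hi_layer e c < m} f f'"
    using fixed[OF f] by (intro omega_segment_prepend[OF T(1) _ f'(1)]) simp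
  then show "\<exists>f'. reaches f f' \<and> (\<forall>c. lo_layer e c \<le> m \<longrightarrow> f' c = act T f c)"
    unfolding reaches_def using f'(2) by blast
qed (rule T(2))

lemma realizable_slice:
  assumes "layer e s = m"
  shows "realizable (\<lambda>n. qt i (Fin s))" "realizable (\<lambda>n. inv (qt i (Fin s)))"
proof -
  have realizable: "realizable (\<lambda>n. T)" if "T \<in> slice_powers e m" "T \<in> basic_twists" for T
    using that(2) layer_preserving_slice_power[OF that(1)] slice_power_fixed[OF that(1) not_in_layers]
    by (rule realizable_twist)
  note slice = qt_in_slice_powers[OF assms, of i]
  show "realizable (\<lambda>n. qt i (Fin s))" using slice by (rule realizable) simp
  show "realizable (\<lambda>n. inv (qt i (Fin s)))" using inv_slice_powers[OF slice] by (rule realizable) simp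
qed

lemma realizable_face:
  assumes "is_inf \<gamma>"
  shows "realizable (\<lambda>n. qt k \<gamma>)" "realizable (\<lambda>n. inv (qt k \<gamma>))"
proof -
  have "qt k \<gamma> \<in> face_twists" using assms by (auto simp: face_twists_def is_inf_def)
  then have face: "act (qt k \<gamma>) g = g" by (rule g_face)
  have g: "g (inv (qt k \<gamma>) c) = g c" for c using fun_cong[OF face, of c] by (simp add: act_def)
  have g': "g (qt k \<gamma> c) = g c" for c using g[of "qt k \<gamma> c"] by simp
  have hi: "hi_layer e (qt k \<gamma> c) = hi_layer e c" "hi_layer e (inv (qt k \<gamma>) c) = hi_layer e c" for c
    by (simp_all add: hi_layer_def)
  show "realizable (\<lambda>n. qt k \<gamma>)" "realizable (\<lambda>n. inv (qt k \<gamma>))"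
    by (intro realizable_twist; simp add: agrees_def act_def inv_inv_eq g g' hi del: Rep_qt)+
qed

lemma realizable_commutator:
  assumes "realizable \<rho>" "realizable (\<lambda>n. inv (\<rho> n))" "realizable \<tau>" "realizable (\<lambda>n. inv (\<tau> n))"
  shows "realizable (\<lambda>n. commutator (\<rho> n) (\<tau> n))" "realizable (\<lambda>n. inv (commutator (\<rho> n) (\<tau> n)))"
proof -
  have "realizable (\<lambda>n. commutator (\<rho> n) (\<tau> n))"
    if "realizable \<rho>" "realizable (\<lambda>n. inv (\<rho> n))" "realizable \<tau>" "realizable (\<lambda>n. inv (\<tau> n))" for \<rho> \<tau>
    unfolding commutator_def using that by (intro realizable_comp)
  from this[OF assms] this[OF assms(3,4,1,2)]
  show "realizable (\<lambda>n. commutator (\<rho> n) (\<tau> n))" "realizable (\<lambda>n. inv (commutator (\<rho> n) (\<tau> n)))"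
    by (simp_all add: inv_commutator realizable_bij[OF assms(1)] realizable_bij[OF assms(3)])
qed

lemma realizable_nested_commutator:
  assumes "layer e s = m" "is_inf \<gamma>" and B: "realizable B" "realizable (\<lambda>n. inv (B n))"
  shows "realizable (\<lambda>n. commutator (commutator (qt i (Fin s)) (B n)) (qt k \<gamma>))"
  using assms by (intro realizable_commutator realizable_slice realizable_face B)

lemma twist_cycle_eq_commutator:
  assumes p: "p \<in> layer_cells e m n" and n: "0 < n" and "i \<noteq> k" and inf: "is_inf (coord k p)"
    and s: "coord i p = Fin s" "layer e s = m"
  obtains j t where "layer e t = n"
    "cycle_of_list [p, rotate_cube i p, rotate_cube k p] =
      commutator (commutator (qt i (Fin s)) (qt j (Fin t))) (qt k (coord k p))"
proof -
  obtain j where ijk: "distinct [i, j, k]" using third_axis[OF \<open>i \<noteq> k\<close>] .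
  then obtain t where t: "coord j p = Fin t" using coord_finite[OF inf, of j] by auto
  have "{m, layer e t} = {m, n}"
    using layers_face[OF ijk inf s(1) t, of e] layers_layer_cells[OF p] s(2) by simp
  then have "layer e t = n" by (auto simp: doubleton_eq_iff)
  moreover have "cycle_of_list [p, rotate_cube i p, rotate_cube k p] =
      commutator (commutator (qt i (Fin s)) (qt j (Fin t))) (qt k (coord k p))"
    using nested_commutator_twists[OF ijk inf not_center_cell_layer_cells[OF p n]] s(1) t by simp
  ultimately show thesis by (rule that)
qed

lemma realizable_twist_cycle:
  assumes "0 < m" "t \<in> twist_cycles e m m"
  shows "realizable (\<lambda>n. t)"
proof -
  obtain p i k s where p: "p \<in> layer_cells e m m" "i \<noteq> k" "is_inf (coord k p)"
      "coord i p = Fin s" "layer e s = m"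
    and t: "t = cycle_of_list [p, rotate_cube i p, rotate_cube k p]"
    using assms(2) unfolding twist_cycles_def by blast
  obtain j r where "layer e r = m"
    "t = commutator (commutator (qt i (Fin s)) (qt j (Fin r))) (qt k (coord k p))"
    unfolding t by (rule twist_cycle_eq_commutator[OF p(1) assms(1) p(2-5)])
  then show ?thesis
    using p realizable_nested_commutator[of s "coord k p" "\<lambda>n. qt j (Fin r)" i k]
    by (simp add: realizable_slice)
qed

definition offdiagonal_cycles :: "nat \<Rightarrow> ('l cell \<Rightarrow> 'l cell) set" where
  "offdiagonal_cycles n = (if m < n then twist_cycles e m n else {})"

definition twist_kinds :: "(axis \<times> 'l dag \<times> axis \<times> 'l ext) set" where
  "twist_kinds = {(i, s, k, \<gamma>). i \<noteq> k \<and> layer e s = m \<and> is_inf \<gamma>}"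

definition aligned_cycles :: "axis \<times> 'l dag \<times> axis \<times> 'l ext \<Rightarrow> nat \<Rightarrow> ('l cell \<Rightarrow> 'l cell) set" where
  "aligned_cycles = (\<lambda>(i, s, k, \<gamma>) n. {cycle_of_list [p, rotate_cube i p, rotate_cube k p] | p.
     m < n \<and> p \<in> layer_cells e m n \<and> coord i p = Fin s \<and> coord k p = \<gamma>})"

lemma finite_twist_kinds: "finite twist_kinds"
proof -
  have "twist_kinds \<subseteq> UNIV \<times> {s. layer e s = m} \<times> UNIV \<times> {PInf, MInf}"
    by (auto simp: twist_kinds_def is_inf_def)
  moreover have "finite (UNIV \<times> {s. layer e s = m} \<times> UNIV \<times> {PInf, MInf} :: (axis \<times> 'l dag \<times> axis \<times> 'l ext) set)"
    using bounded_layer(1)[OF bij_is_inj[OF bij_e]] by (intro finite_SigmaI) (simp_all add: UNIV_axis)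
  ultimately show ?thesis by (rule finite_subset)
qed

lemma offdiagonal_cycles_aligned:
  assumes "t \<in> offdiagonal_cycles n"
  shows "\<exists>\<kappa>\<in>twist_kinds. t \<in> aligned_cycles \<kappa> n"
proof -
  obtain p i k s where p: "m < n" "p \<in> layer_cells e m n" "coord i p = Fin s"
    and kind: "i \<noteq> k" "layer e s = m" "is_inf (coord k p)"
    and t: "t = cycle_of_list [p, rotate_cube i p, rotate_cube k p]"
    using assms unfolding offdiagonal_cycles_def twist_cycles_def
    by (auto split: if_splits simp del: cycle_of_list.simps)
  have "(i, s, k, coord k p) \<in> twist_kinds" using kind by (simp add: twist_kinds_def)
  moreover have "t \<in> aligned_cycles (i, s, k, coord k p) n"
    unfolding aligned_cycles_def t prod.case using p by blast
  ultimately show ?thesis by blast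
qed

text \<open>
  The twist of layer \<open>m\<close> and the face twist are shared by all \<open>n\<close>; only the third twist depends on \<open>n\<close>.
\<close>

lemma realizable_aligned_cycles:
  assumes "\<kappa> \<in> twist_kinds" and \<rho>: "\<And>n. \<rho> n \<in> insert id (aligned_cycles \<kappa> n)"
  shows "realizable \<rho>"
proof -
  obtain i s k \<gamma> where \<kappa>: "\<kappa> = (i, s, k, \<gamma>)" and kind: "i \<noteq> k" "layer e s = m" "is_inf \<gamma>"
    using assms(1) unfolding twist_kinds_def by blast
  have "\<exists>B. (m < n \<longrightarrow> B \<in> slice_powers e n) \<and> (n \<le> m \<longrightarrow> B = id) \<and>
    \<rho> n = commutator (commutator (qt i (Fin s)) B) (qt k \<gamma>)" for n
  proof (cases "\<rho> n = id")
    case True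
    then show ?thesis
      using id_in_slice_powers[OF bij_is_surj[OF bij_e]] by (intro exI[of _ id]) simp
  next
    case False
    then obtain p where "m < n" and p: "p \<in> layer_cells e m n" "coord i p = Fin s" "coord k p = \<gamma>"
      "\<rho> n = cycle_of_list [p, rotate_cube i p, rotate_cube k p]"
      using \<rho>[of n] unfolding aligned_cycles_def \<kappa> prod.case by blast
    have "0 < n" "is_inf (coord k p)" using \<open>m < n\<close> p(3) kind(3) by simp_all
    obtain j t where "layer e t = n" "\<rho> n = commutator (commutator (qt i (Fin s)) (qt j (Fin t))) (qt k \<gamma>)"
      unfolding p(4) p(3)[symmetric]
      by (rule twist_cycle_eq_commutator[OF p(1) \<open>0 < n\<close> kind(1) \<open>is_inf (coord k p)\<close> p(2) kind(2)])
    then show ?thesis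
      using qt_in_slice_powers[of e t n j] \<open>m < n\<close> by (intro exI[of _ "qt j (Fin t)"]) simp
  qed
  then obtain B where B: "\<And>n. m < n \<Longrightarrow> B n \<in> slice_powers e n" "\<And>n. n \<le> m \<Longrightarrow> B n = id"
    and eq: "\<rho> = (\<lambda>n. commutator (commutator (qt i (Fin s)) (B n)) (qt k \<gamma>))"
    by metis
  have "realizable B" using B by (rule realizable_layerwise)
  moreover have "realizable (\<lambda>n. inv (B n))"
    using inv_slice_powers[OF B(1)] by (rule realizable_layerwise) (simp_all add: B(2))
  ultimately show ?thesis unfolding eq using kind(2,3) by (intro realizable_nested_commutator)
qed

lemma realizable_offdiagonal_cycles:
  assumes "\<And>n. \<rho> n \<in> insert id (offdiagonal_cycles n)"
  shows "realizable \<rho>"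
proof -
  have "\<exists>\<kappa>\<in>twist_kinds. \<rho> n \<in> aligned_cycles \<kappa> n" if "\<rho> n \<noteq> id" for n
    using assms[of n] that offdiagonal_cycles_aligned by blast
  then obtain \<kappa> where \<kappa>: "\<And>n. \<rho> n \<noteq> id \<Longrightarrow> \<kappa> n \<in> twist_kinds \<and> \<rho> n \<in> aligned_cycles (\<kappa> n) n" by metis
  have "realizable (\<lambda>n. if \<kappa> n \<in> twist_kinds then \<rho> n else id)"
  proof (rule realizable_piecewise[OF finite_twist_kinds])
    show "realizable (\<lambda>n. if \<kappa> n = \<beta> then \<rho> n else id)" if "\<beta> \<in> twist_kinds" for \<beta>
      using that
    proof (rule realizable_aligned_cycles)
      show "(if \<kappa> n = \<beta> then \<rho> n else id) \<in> insert id (aligned_cycles \<beta> n)" for n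
        using \<kappa>[of n] by auto
    qed
  qed
  moreover have "(if \<kappa> n \<in> twist_kinds then \<rho> n else id) = \<rho> n" for n
    using \<kappa>[of n] by (cases "\<rho> n = id") simp_all
  ultimately show ?thesis by simp
qed

lemma realizable_words:
  assumes "\<And>n. \<rho> n \<in> words (insert id (offdiagonal_cycles n)) N"
  shows "realizable \<rho>"
  using assms
proof (induction N arbitrary: \<rho>)
  case 0
  then have "\<rho> = (\<lambda>n. id)" by (auto simp: fun_eq_iff)
  then show ?case using realizable_id by metis
next
  case (Suc N)
  then have "\<exists>s t. s \<in> insert id (offdiagonal_cycles n) \<and> t \<in> words (insert id (offdiagonal_cycles n)) N
    \<and> \<rho> n = s \<circ> t" for n
    unfolding words.simps by blast
  then obtain s t where s: "\<And>n. s n \<in> insert id (offdiagonal_cycles n)"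
    and t: "\<And>n. t n \<in> words (insert id (offdiagonal_cycles n)) N" and "\<And>n. \<rho> n = s n \<circ> t n"
    by metis
  then have \<rho>: "\<rho> = (\<lambda>n. s n \<circ> t n)" by blast
  show ?case unfolding \<rho> by (rule realizable_comp[OF realizable_offdiagonal_cycles[OF s] Suc.IH[OF t]])
qed

lemma realizable_comp_closure:
  assumes "p \<in> comp_closure E" "\<And>t. t \<in> E \<Longrightarrow> realizable (\<lambda>n. t)"
  shows "realizable (\<lambda>n. p)"
  using assms(1)
proof (induction rule: comp_closure_induct)
  case id
  show ?case by (rule realizable_id)
next
  case (comp s t)
  show ?case using realizable_comp[OF assms(2)[OF comp(1)] comp(3)] .
qed

lemma recolour_standard:
  assumes "standard f" "0 < n"
  shows "\<exists>p\<in>comp_closure (twist_cycles e m n). \<forall>c. c \<in> layer_cells e m n \<or> f c = g c \<longrightarrow> act p f c = g c"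
proof -
  have "\<exists>p\<in>comp_closure (twist_cycles e m n). p permutes layer_cells e m n \<and>
    (\<forall>c\<in>layer_cells e m n. act p f c = g c)"
  proof (rule recolour_layer_cells[OF assms(2) bij_is_inj[OF bij_e]])
    fix c assume "c \<in> layer_cells e m n"
    then have "\<not> center_cell c" using assms(2) by (rule not_center_cell_layer_cells)
    then show "card {d \<in> cluster c. f d = v} = card {d \<in> cluster c. g d = v}"
      "\<exists>z\<in>cluster c. \<exists>w\<in>cluster c. z \<noteq> w \<and> g z = g w" for v
      using standard_cards[OF assms(1) standard_g] standard_repeated_colour[OF standard_g] by blast+
  qed
  then obtain p where p: "p \<in> comp_closure (twist_cycles e m n)" "p permutes layer_cells e m n"
    "\<And>c. c \<in> layer_cells e m n \<Longrightarrow> act p f c = g c" by blast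
  have "act p f c = f c" if "c \<notin> layer_cells e m n" for c
    using that permutes_not_in[OF permutes_inv[OF p(2)]] by (simp add: act_def)
  then have "\<forall>c. c \<in> layer_cells e m n \<or> f c = g c \<longrightarrow> act p f c = g c" using p(3) by metis
  with p(1) show ?thesis by blast
qed

lemma solve_offdiagonal:
  assumes f: "standard f" and solved: "\<And>c. lo_layer e c < m \<or> hi_layer e c = m \<Longrightarrow> f c = g c"
  shows "\<exists>f'. reaches f f' \<and> (\<forall>c. lo_layer e c \<le> m \<longrightarrow> f' c = g c)"
proof -
  have "\<exists>p\<in>comp_closure (offdiagonal_cycles n).
    \<forall>c. lo_layer e c \<le> m \<and> hi_layer e c = n \<longrightarrow> act p f c = g c" for n
  proof (cases "m < n")
    case True
    then obtain p where p: "p \<in> comp_closure (offdiagonal_cycles n)"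
      "\<And>c. c \<in> layer_cells e m n \<or> f c = g c \<Longrightarrow> act p f c = g c"
      using recolour_standard[OF f, of n] unfolding offdiagonal_cycles_def by auto
    have "c \<in> layer_cells e m n \<or> f c = g c" if "lo_layer e c \<le> m" "hi_layer e c = n" for c
      using that solved[of c] by (auto simp: layer_cells_def le_less)
    with p show ?thesis by blast
  next
    case False
    have "f c = g c" if "lo_layer e c \<le> m" "hi_layer e c = n" for c
      using that False lo_layer_le_hi_layer[of e c] by (intro solved) linarith
    then show ?thesis by (intro bexI[of _ id]) simp_all
  qed
  then obtain \<rho> where \<rho>: "\<And>n. \<rho> n \<in> comp_closure (offdiagonal_cycles n)"
    "\<And>c. lo_layer e c \<le> m \<Longrightarrow> act (\<rho> (hi_layer e c)) f c = g c"
    by metis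
  obtain M where M: "\<And>n. card (layer_cells e m n) \<le> M"
    using bounded_layer_cells(2)[OF bij_is_inj[OF bij_e]] by blast
  have "\<rho> n \<in> words (insert id (offdiagonal_cycles n)) (fact M * fact M)" for n
  proof (rule subsetD[OF comp_closure_subset_words \<rho>(1)])
    show "s permutes layer_cells e m n" if "s \<in> offdiagonal_cycles n" for s
      using that twist_cycles_permutes unfolding offdiagonal_cycles_def by (auto split: if_splits)
  qed (rule bounded_layer_cells(1)[OF bij_is_inj[OF bij_e]], rule M)
  then have "realizable \<rho>" by (rule realizable_words)
  moreover have "agrees f" using solved by (intro agreesI) blast
  ultimately show ?thesis using \<rho>(2) unfolding realizable_def by metis
qed

lemma solve_diagonal:
  assumes f: "standard f" and solved: "\<And>c. lo_layer e c < m \<Longrightarrow> f c = g c"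
  shows "\<exists>f'. reaches f f' \<and> (\<forall>c. lo_layer e c < m \<or> hi_layer e c = m \<longrightarrow> f' c = g c)"
proof -
  obtain p where p: "realizable (\<lambda>n. p)" "\<And>c. lo_layer e c < m \<or> hi_layer e c = m \<Longrightarrow> act p f c = g c"
  proof (cases "m = 0")
    case True
    obtain p where p: "p \<in> comp_closure center_turns" "\<And>c. center_cell c \<Longrightarrow> act p f c = g c"
      using center_reachable[of f g] f standard_g unfolding standard_iff by blast
    have "realizable (\<lambda>n. t)" if "t \<in> center_turns" for t
      using that realizable_slice[of Zero] True by (auto simp: center_turns_def)
    then have "realizable (\<lambda>n. p)" by (rule realizable_comp_closure[OF p(1)])
    then show thesis using p(2) True by (intro that[of p]) (simp_all add: center_cell_iff_hi_layer[of _ e])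
  next
    case False
    then obtain p where p: "p \<in> comp_closure (twist_cycles e m m)"
      "\<And>c. c \<in> layer_cells e m m \<or> f c = g c \<Longrightarrow> act p f c = g c"
      using recolour_standard[OF f, of m] by auto
    have "realizable (\<lambda>n. p)"
      using p(1) by (rule realizable_comp_closure[OF _ realizable_twist_cycle]) (use False in simp)
    moreover have "c \<in> layer_cells e m m \<or> f c = g c" if "lo_layer e c < m \<or> hi_layer e c = m" for c
      using that solved[of c] lo_layer_le_hi_layer[of e c] by (auto simp: layer_cells_def le_less)
    ultimately show thesis using p(2) by (intro that) blast+
  qed
  have "agrees f" using solved by (rule agreesI)
  with p(1) obtain f' where f': "reaches f f'" "\<And>c. lo_layer e c \<le> m \<Longrightarrow> f' c = act p f c"
    unfolding realizable_def by blast
  have "f' c = g c" if "lo_layer e c < m \<or> hi_layer e c = m" for c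
    using f'(2)[of c] p(2)[OF that] that lo_layer_le_hi_layer[of e c] by auto
  with f'(1) show ?thesis by blast
qed

lemma solve_stage:
  assumes f: "standard f" and solved: "\<And>c. lo_layer e c < m \<Longrightarrow> f c = g c"
  shows "\<exists>f'. reaches f f' \<and> standard f' \<and> (\<forall>c. lo_layer e c \<le> m \<longrightarrow> f' c = g c)"
proof -
  obtain h where h: "reaches f h" "\<And>c. lo_layer e c < m \<or> hi_layer e c = m \<Longrightarrow> h c = g c"
    using solve_diagonal[OF f solved] by blast
  obtain h' where h': "reaches h h'" "\<And>c. lo_layer e c \<le> m \<Longrightarrow> h' c = g c"
    using solve_offdiagonal[OF reaches_standard[OF h(1) f] h(2)] by blast
  have "reaches f h'" using h(1) h'(1) by (rule reaches_trans)
  then show ?thesis using h'(2) reaches_standard[OF _ f] by blast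
qed

end

section \<open>Runs of length omega squared\<close>

definition next_position :: "(nat \<Rightarrow> nat) \<Rightarrow> nat \<times> nat \<Rightarrow> nat \<times> nat" where
  "next_position l = (\<lambda>(m, i). if Suc i < l m then (m, Suc i) else (Suc m, 0))"

lemma next_position_in_block:
  assumes "j < l m"
  shows "(next_position l ^^ j) (m, 0) = (m, j)"
  using assms by (induction j) (simp_all add: next_position_def)

lemma next_position_bounded:
  assumes "\<And>m. 0 < l m"
  shows "snd ((next_position l ^^ n) (0, 0)) < l (fst ((next_position l ^^ n) (0, 0)))"
  by (induction n) (auto simp: next_position_def assms split: prod.split)

lemma next_position_reaches_block:
  assumes "\<And>m. 0 < l m"
  shows "\<exists>n. (next_position l ^^ n) (0, 0) = (m, 0)"
proof (induction m)
  case 0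
  show ?case by (rule exI[of _ 0]) simp
next
  case (Suc m)
  then obtain n where n: "(next_position l ^^ n) (0, 0) = (m, 0)" by blast
  obtain j where j: "l m = Suc j" using assms[of m] gr0_conv_Suc by blast
  have "(next_position l ^^ (Suc j + n)) (0, 0) = next_position l (m, j)"
    using n next_position_in_block[of j l m] j by (simp add: funpow_add)
  also have "\<dots> = (Suc m, 0)" by (simp add: next_position_def j)
  finally show ?case by blast
qed

lemma filterlim_next_position:
  assumes "\<And>m. 0 < l m"
  shows "filterlim (\<lambda>n. fst ((next_position l ^^ n) (0, 0))) at_top sequentially"
proof -
  have "mono (\<lambda>n. fst ((next_position l ^^ n) (0, 0)))"
    unfolding mono_iff_le_Suc by (simp add: next_position_def split: prod.split)
  then show ?thesis
    unfolding filterlim_at_top eventually_sequentially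
    using next_position_reaches_block[of l, OF assms] by (metis (no_types, lifting) fst_conv monoD)
qed

lemma chain_of_tranclp:
  assumes "\<And>m. (R m)\<^sup>+\<^sup>+ (x m) (x (Suc m))"
  obtains y s where "y 0 = x 0" "\<And>n. R (s n) (y n) (y (Suc n))" "\<And>n. (R (s n))\<^sup>*\<^sup>* (x (s n)) (y n)"
    "filterlim s at_top sequentially"
proof -
  have "\<exists>l p. 0 < l \<and> p 0 = x m \<and> p l = x (Suc m) \<and> (\<forall>i<l. R m (p i) (p (Suc i)))" for m
    using assms[of m] unfolding tranclp_power relpowp_fun_conv by blast
  then obtain l p where l: "\<And>m. 0 < l m" and p: "\<And>m. p m 0 = x m" "\<And>m. p m (l m) = x (Suc m)"
    "\<And>m i. i < l m \<Longrightarrow> R m (p m i) (p m (Suc i))" by metis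
  define s where "s n = fst ((next_position l ^^ n) (0, 0))" for n
  define i where "i n = snd ((next_position l ^^ n) (0, 0))" for n
  define y where "y n = p (s n) (i n)" for n
  have i_less: "i n < l (s n)" for n
    using next_position_bounded[of l n, OF l] by (simp add: i_def s_def)
  have "(s (Suc n), i (Suc n)) = (if Suc (i n) < l (s n) then (s n, Suc (i n)) else (Suc (s n), 0))" for n
    by (simp add: s_def i_def next_position_def split: prod.split)
  moreover have "Suc (i n) = l (s n)" if "\<not> Suc (i n) < l (s n)" for n using i_less[of n] that by simp
  ultimately have "y (Suc n) = p (s n) (Suc (i n))" for n
    unfolding y_def by (metis p(1,2) prod.inject)
  then have step: "R (s n) (y n) (y (Suc n))" for n using p(3)[OF i_less] by (simp add: y_def)
  have "(R m)\<^sup>*\<^sup>* (x m) (p m j)" if "j \<le> l m" for m j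
    using that
  proof (induction j)
    case (Suc j)
    then show ?case using rtranclp.rtrancl_into_rtrancl[of "R m" "x m" "p m j"] p(3)[of j m] by simp
  qed (simp add: p(1))
  then have "(R (s n))\<^sup>*\<^sup>* (x (s n)) (y n)" for n using i_less[of n] by (simp add: y_def)
  moreover have "y 0 = x 0" by (simp add: y_def s_def i_def p(1))
  moreover have "filterlim s at_top sequentially"
    unfolding s_def by (rule filterlim_next_position[OF l])
  ultimately show thesis using step by (intro that)
qed

lemma omega2_iff: "((a, b), (c, d)) \<in> omega2 \<longleftrightarrow> a < c \<or> a = c \<and> b \<le> d"
  by (simp add: omega2_def)

definition pull_omega2 :: "('o \<Rightarrow> nat \<times> nat) \<Rightarrow> 'o rel" where
  "pull_omega2 d = inv_image omega2 d"

lemma pull_omega2_iff: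
  "(x, y) \<in> pull_omega2 d \<longleftrightarrow> fst (d x) < fst (d y) \<or> fst (d x) = fst (d y) \<and> snd (d x) \<le> snd (d y)"
  by (cases "d x"; cases "d y") (simp add: pull_omega2_def omega2_iff)

lemma Field_pull_omega2 [simp]: "Field (pull_omega2 d) = UNIV"
proof -
  have "(x, x) \<in> pull_omega2 d" for x by (simp add: pull_omega2_iff)
  then show ?thesis using FieldI1 by fast
qed

lemma Well_order_pull_omega2:
  assumes "inj d"
  shows "Well_order (pull_omega2 d)"
proof -
  have eq: "x = y" if "fst (d x) = fst (d y)" "snd (d x) = snd (d y)" for x y
    using assms that by (simp add: inj_def prod_eq_iff)
  have "pull_omega2 d - Id \<subseteq> inv_image (less_than <*lex*> less_than) d"
  proof
    fix xy assume "xy \<in> pull_omega2 d - Id"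
    then obtain x y where xy: "xy = (x, y)" "(x, y) \<in> pull_omega2 d" "x \<noteq> y" by (cases xy) auto
    then have "fst (d x) < fst (d y) \<or> fst (d x) = fst (d y) \<and> snd (d x) < snd (d y)"
      using eq[of x y] by (auto simp: pull_omega2_iff le_less)
    then show "xy \<in> inv_image (less_than <*lex*> less_than) d"
      unfolding xy(1) by (cases "d x"; cases "d y") simp
  qed
  then have "wf (pull_omega2 d - Id)"
    by (rule wf_subset[rotated]) (intro wf_inv_image wf_lex_prod wf_less_than)
  moreover have "antisym (pull_omega2 d)" using eq by (auto simp: antisym_def pull_omega2_iff)
  ultimately show ?thesis
    unfolding well_order_on_def linear_order_on_def partial_order_on_def preorder_on_def
    by (auto simp: refl_on_def trans_def total_on_def pull_omega2_iff)
qed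

lemma underS_pull_omega2_iff:
  assumes "inj d"
  shows "\<xi> \<in> underS (pull_omega2 d) \<eta> \<longleftrightarrow>
    fst (d \<xi>) < fst (d \<eta>) \<or> fst (d \<xi>) = fst (d \<eta>) \<and> snd (d \<xi>) < snd (d \<eta>)"
proof -
  have "\<xi> = \<eta> \<longleftrightarrow> fst (d \<xi>) = fst (d \<eta>) \<and> snd (d \<xi>) = snd (d \<eta>)"
    using assms by (metis injD prod_eq_iff)
  then show ?thesis by (auto simp: underS_def pull_omega2_iff)
qed

lemma immediate_pred_pull_omega2:
  assumes "bij d"
  shows "immediate_pred (pull_omega2 d) \<zeta> \<eta> \<longleftrightarrow> d \<eta> = (fst (d \<zeta>), Suc (snd (d \<zeta>)))"
proof
  assume pred: "immediate_pred (pull_omega2 d) \<zeta> \<eta>"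
  obtain \<xi> where \<xi>: "d \<xi> = (fst (d \<zeta>), Suc (snd (d \<zeta>)))" using assms by (metis bij_pointE)
  have "d \<zeta> \<noteq> d \<eta>" using pred assms by (auto simp: immediate_pred_def bij_is_inj inj_eq)
  then have "(\<zeta>, \<xi>) \<in> pull_omega2 d" "(\<xi>, \<eta>) \<in> pull_omega2 d" "\<xi> \<noteq> \<zeta>"
    using pred \<xi> unfolding immediate_pred_def by (auto simp: pull_omega2_iff prod_eq_iff)
  then show "d \<eta> = (fst (d \<zeta>), Suc (snd (d \<zeta>)))" using pred \<xi> unfolding immediate_pred_def by metis
next
  assume \<eta>: "d \<eta> = (fst (d \<zeta>), Suc (snd (d \<zeta>)))"
  have "d \<xi> = d \<zeta> \<or> d \<xi> = d \<eta>" if "(\<zeta>, \<xi>) \<in> pull_omega2 d" "(\<xi>, \<eta>) \<in> pull_omega2 d" for \<xi>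
    using that \<eta> unfolding pull_omega2_iff prod_eq_iff by simp linarith
  moreover have "d \<xi> = d \<xi>' \<longleftrightarrow> \<xi> = \<xi>'" for \<xi> \<xi>' using assms by (simp add: bij_is_inj inj_eq)
  moreover have "(\<zeta>, \<eta>) \<in> pull_omega2 d" "d \<zeta> \<noteq> d \<eta>"
    using \<eta> by (simp_all add: pull_omega2_iff prod_eq_iff)
  ultimately show "immediate_pred (pull_omega2 d) \<zeta> \<eta>"
    unfolding immediate_pred_def by metis
qed

lemma limit_pull_omega2:
  assumes d: "bij d" and "underS (pull_omega2 d) \<eta> \<noteq> {}" "\<nexists>\<zeta>. immediate_pred (pull_omega2 d) \<zeta> \<eta>"
  obtains m where "d \<eta> = (Suc m, 0)"
proof -
  have "d \<eta> \<noteq> (0, 0)"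
    using assms(2) by (auto simp: underS_pull_omega2_iff[OF bij_is_inj[OF d]])
  moreover have "snd (d \<eta>) \<noteq> Suc k" for k
  proof
    assume "snd (d \<eta>) = Suc k"
    moreover obtain \<xi> where "d \<xi> = (fst (d \<eta>), k)" using d by (metis bij_pointE)
    ultimately have "immediate_pred (pull_omega2 d) \<xi> \<eta>"
      by (simp add: immediate_pred_pull_omega2[OF d] prod_eq_iff)
    with assms(3) show False by blast
  qed
  ultimately show thesis by (metis that nat.exhaust prod.collapse)
qed

lemma evconst_pull_omega2_limit:
  assumes d: "bij d" and \<eta>: "d \<eta> = (Suc m, 0)" and "\<forall>\<^sub>F k in sequentially. F (m, k) c = v"
  shows "evconst (pull_omega2 d) (\<lambda>\<zeta>. \<zeta> \<in> underS (pull_omega2 d) \<eta>) (F \<circ> d) c = v"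
proof -
  interpret wo_rel "pull_omega2 d"
    using Well_order_pull_omega2[OF bij_is_inj[OF d]] by unfold_locales
  note underS_iff = underS_pull_omega2_iff[OF bij_is_inj[OF d]]
  obtain K where K: "\<And>k. K \<le> k \<Longrightarrow> F (m, k) c = v"
    using assms(3) unfolding eventually_sequentially by blast
  obtain \<zeta> where \<zeta>: "d \<zeta> = (m, K)" using d by (metis bij_pointE)
  show ?thesis
  proof (rule evconst_eqI)
    show "\<zeta> \<in> underS \<eta>" using \<zeta> \<eta> by (simp add: underS_iff)
    fix \<xi> assume "\<xi> \<in> underS \<eta>" "(\<zeta>, \<xi>) \<in> pull_omega2 d"
    then have "fst (d \<xi>) = m \<and> K \<le> snd (d \<xi>)"
      using \<zeta> \<eta> by (auto simp: underS_iff pull_omega2_iff)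
    then show "(F \<circ> d) \<xi> c = v" using K by (cases "d \<xi>") simp
  qed simp
qed

lemma run_ok_pull_omega2:
  assumes d: "bij d" and F_0: "F (0, 0) = f"
    and F_Suc: "\<And>m k. F (m, Suc k) = act (\<sigma> (m, k)) (F (m, k))"
    and F_lim: "\<And>m c. \<forall>\<^sub>F k in sequentially. F (m, k) c = F (Suc m, 0) c"
  shows "run_ok (pull_omega2 d) (\<sigma> \<circ> d) f (F \<circ> d)"
proof -
  interpret wo_rel "pull_omega2 d"
    using Well_order_pull_omega2[OF bij_is_inj[OF d]] by unfold_locales
  show ?thesis
    unfolding run_ok_iff
  proof (intro ballI conjI impI allI)
    fix \<eta>
    show "(F \<circ> d) \<eta> = f" if "underS \<eta> = {}"
    proof -
      obtain \<zeta> where "d \<zeta> = (0, 0)" using d by (metis bij_pointE)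
      then have "fst (d \<eta>) = 0 \<and> snd (d \<eta>) = 0"
        using that underS_pull_omega2_iff[OF bij_is_inj[OF d], of \<zeta> \<eta>] by auto
      then show ?thesis using F_0 by (cases "d \<eta>") simp
    qed
    show "(F \<circ> d) \<eta> = act ((\<sigma> \<circ> d) \<zeta>) ((F \<circ> d) \<zeta>)" if "immediate_pred (pull_omega2 d) \<zeta> \<eta>" for \<zeta>
      using that F_Suc by (cases "d \<zeta>") (simp add: immediate_pred_pull_omega2[OF d])
    assume "underS \<eta> \<noteq> {} \<and> (\<nexists>\<zeta>. immediate_pred (pull_omega2 d) \<zeta> \<eta>)"
    then obtain m where \<eta>: "d \<eta> = (Suc m, 0)" using limit_pull_omega2[OF d] by blast
    have "evconst (pull_omega2 d) (\<lambda>\<zeta>. \<zeta> \<in> underS \<eta>) (F \<circ> d) c = F (Suc m, 0) c" for c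
      using F_lim by (rule evconst_pull_omega2_limit[OF d \<eta>])
    then show "(F \<circ> d) \<eta> = evconst (pull_omega2 d) (\<lambda>\<zeta>. \<zeta> \<in> underS \<eta>) (F \<circ> d)"
      by (simp add: fun_eq_iff \<eta>)
  qed
qed

lemma terminal_pull_omega2:
  assumes d: "bij d" and F_terminal: "\<And>c. \<forall>\<^sub>F m in sequentially. \<forall>k. F (m, k) c = g c"
  shows "terminal (pull_omega2 d) \<sigma> f (F \<circ> d) = g"
proof
  fix c
  interpret wo_rel "pull_omega2 d"
    using Well_order_pull_omega2[OF bij_is_inj[OF d]] by unfold_locales
  have "\<exists>\<zeta>. (\<zeta>, \<eta>) \<notin> pull_omega2 d" for \<eta>
  proof -
    obtain \<zeta> where "d \<zeta> = (Suc (fst (d \<eta>)), 0)" using d by (metis bij_pointE)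
    then have "(\<zeta>, \<eta>) \<notin> pull_omega2 d" by (simp add: pull_omega2_iff)
    then show ?thesis by blast
  qed
  then have "terminal (pull_omega2 d) \<sigma> f (F \<circ> d) c = evconst (pull_omega2 d) (\<lambda>\<zeta>. \<zeta> \<in> UNIV) (F \<circ> d) c"
    using terminal_eq_evconst[of "pull_omega2 d" \<sigma> f "F \<circ> d"] by simp
  also obtain M where M: "\<And>m k. M \<le> m \<Longrightarrow> F (m, k) c = g c"
    using F_terminal[of c] unfolding eventually_sequentially by blast
  obtain \<zeta> where \<zeta>: "d \<zeta> = (M, 0)" using d by (metis bij_pointE)
  have "evconst (pull_omega2 d) (\<lambda>\<zeta>. \<zeta> \<in> UNIV) (F \<circ> d) c = g c"
  proof (rule evconst_eqI)
    fix \<eta> assume "(\<zeta>, \<eta>) \<in> pull_omega2 d"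
    then show "(F \<circ> d) \<eta> c = g c" using M by (cases "d \<eta>") (auto simp: pull_omega2_iff \<zeta>)
  qed simp_all
  finally show "terminal (pull_omega2 d) \<sigma> f (F \<circ> d) c = g c" .
qed

lemma accessible_via_pull_omega2:
  assumes "bij d" "\<And>m k. \<sigma> (m, k) \<in> basic_twists" "F (0, 0) = f"
    and "\<And>m k. F (m, Suc k) = act (\<sigma> (m, k)) (F (m, k))"
    and "\<And>m c. \<forall>\<^sub>F k in sequentially. F (m, k) c = F (Suc m, 0) c"
    and "\<And>c. \<forall>\<^sub>F m in sequentially. \<forall>k. F (m, k) c = g c"
  shows "accessible_via (pull_omega2 d) f g"
  unfolding accessible_via_def
proof (intro conjI exI)
  show "Well_order (pull_omega2 d)" by (rule Well_order_pull_omega2[OF bij_is_inj[OF assms(1)]])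
  show "\<forall>\<eta>\<in>Field (pull_omega2 d). (\<sigma> \<circ> d) \<eta> \<in> basic_twists"
    using assms(2) by (metis comp_apply prod.exhaust)
  show "run_ok (pull_omega2 d) (\<sigma> \<circ> d) f (F \<circ> d)" by (rule run_ok_pull_omega2) fact+
  show "g = terminal (pull_omega2 d) (\<sigma> \<circ> d) f (F \<circ> d)"
    using terminal_pull_omega2[of d F g, OF assms(1,6)] by simp
qed

lemma solve_stages:
  assumes "bij e" "f \<in> S_std" "g \<in> S_face"
  obtains x where "x 0 = f" "\<And>m c. lo_layer e c < m \<Longrightarrow> x m c = g c"
    "\<And>m. (omega_segment {c. hi_layer e c < m})\<^sup>+\<^sup>+ (x m) (x (Suc m))"
proof -
  have stage: "stage e g" using assms(1,3) by unfold_locales (auto simp: S_face_def)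
  let ?solved = "\<lambda>m h. standard h \<and> (\<forall>c. lo_layer e c < m \<longrightarrow> h c = g c) \<and> (m = 0 \<longrightarrow> h = f)"
  have "\<exists>x. \<forall>m. ?solved m (x m) \<and> (omega_segment {c. hi_layer e c < m})\<^sup>+\<^sup>+ (x m) (x (Suc m))"
  proof (rule dependent_nat_choice)
    show "\<exists>h. ?solved 0 h" using assms(2) by (auto simp: S_std_def)
    show "\<exists>h'. ?solved (Suc m) h' \<and> (omega_segment {c. hi_layer e c < m})\<^sup>+\<^sup>+ h h'"
      if "?solved m h" for h m
      using stage.solve_stage[OF stage, of h m] that
      unfolding stage.reaches_def[OF stage] by (auto simp: less_Suc_eq_le)
  qed
  with that show thesis by blast
qed

lemma accessible_S_face:
  fixes f g :: "'l config" and d :: "'o \<Rightarrow> nat \<times> nat"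
  assumes L: "countable (UNIV :: 'l set)" "infinite (UNIV :: 'l set)" and "bij d"
    and f: "f \<in> S_std" and g: "g \<in> S_face"
  shows "accessible_via (pull_omega2 d) f g"
proof -
  obtain e :: "'l \<Rightarrow> nat" where e: "bij e" using countableE_infinite[OF L] .
  define D where "D m = {c :: 'l cell. hi_layer e c < m}" for m
  obtain x where x: "x 0 = f" "\<And>m c. lo_layer e c < m \<Longrightarrow> x m c = g c"
    "\<And>m. (omega_segment (D m))\<^sup>+\<^sup>+ (x m) (x (Suc m))"
    by (rule solve_stages[OF e f g]) (rule that[unfolded D_def])
  obtain y s where y_0: "y 0 = x 0" and seg: "\<And>n. omega_segment (D (s n)) (y n) (y (Suc n))"
    and reach: "\<And>n. (omega_segment (D (s n)))\<^sup>*\<^sup>* (x (s n)) (y n)" and s: "filterlim s at_top sequentially"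
    by (rule chain_of_tranclp[of "\<lambda>m. omega_segment (D m)" x, OF x(3)]) (rule that)
  obtain \<sigma> F where "\<And>n. omega_run (D (s n)) (\<sigma> n) (F n) (y n) (y (Suc n))"
    using seg unfolding omega_segment_def by metis
  then have F: "\<And>n k. \<sigma> n k \<in> basic_twists" "\<And>n. F n 0 = y n" "\<And>n k. F n (Suc k) = act (\<sigma> n k) (F n k)"
    "\<And>n c. \<forall>\<^sub>F k in sequentially. F n k c = y (Suc n) c" "\<And>n c k. c \<in> D (s n) \<Longrightarrow> F n k c = y n c"
    unfolding omega_run_def by blast+
  have y_const: "y n c = x (s n) c" if "c \<in> D (s n)" for n c
    using reach[of n] by (induction rule: rtranclp_induct) (simp_all add: omega_segment_const[OF _ that])
  have F_solved: "F n k c = g c" if "Suc (hi_layer e c) \<le> s n" for n k c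
  proof -
    have "c \<in> D (s n)" "lo_layer e c < s n"
      using that lo_layer_le_hi_layer[of e c] by (simp_all add: D_def)
    then show ?thesis using F(5) y_const x(2) by simp
  qed
  have "\<forall>\<^sub>F n in sequentially. \<forall>k. F n k c = g c" for c
    using s F_solved unfolding filterlim_at_top by (blast intro: eventually_mono)
  then show ?thesis
    using F(1-4) y_0 x(1)
    by (intro accessible_via_pull_omega2[OF \<open>bij d\<close>, of "case_prod \<sigma>" "case_prod F"]) simp_all
qed

lemma accessible_act:
  assumes "T \<in> basic_twists"
  shows "accessible TYPE('o) f (act T f)"
proof -
  let ?r = "{(undefined, undefined)} :: 'o rel"
  have "Well_order ?r"
    by (auto simp: order_on_defs refl_on_def trans_def antisym_def total_on_def)
  moreover have "run_ok ?r (\<lambda>_. T) f (\<lambda>_. f)" by (simp add: run_ok_def Field_def)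
  moreover have "act T f = terminal ?r (\<lambda>_. T) f (\<lambda>_. f)" by (simp add: terminal_def Field_def)
  ultimately have "accessible_via ?r f (act T f)"
    unfolding accessible_via_def using assms by (intro conjI exI[of _ "\<lambda>_. T"] exI[of _ "\<lambda>_. f"]) simp_all
  then show ?thesis unfolding accessible_def ..
qed

lemma act_f_solved_in_L_solved:
  assumes "T \<in> basic_twists"
  shows "act T f_solved \<in> L_solved TYPE('o)"
  using legal_f_solved accessible_act[OF assms] by (auto simp: L_solved_def legal_def act_def)

lemma twisted_f_solved_not_in_S_face:
  fixes a :: 'l
  shows "act (qt AX (Fin (Pos a))) f_solved \<notin> S_face"
proof
  let ?A = "qt AX (Fin (Pos a)) :: 'l cell \<Rightarrow> 'l cell" and ?F = "qt AY PInf :: 'l cell \<Rightarrow> 'l cell"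
  let ?c = "face_cell Blue (Zero, Pos a)" and ?d = "face_cell Blue (Pos a, Zero)"
  assume "act ?A f_solved \<in> S_face"
  moreover have "?F \<in> face_twists" unfolding face_twists_def by blast
  ultimately have "act ?F (act ?A f_solved) = act ?A f_solved" by (simp add: S_face_def)
  moreover have "?A (face_cell Yellow (Zero, Pos a)) = ?c" "?F ?d = ?c" "?A ?d = ?d"
    by (simp_all flip: Rep_cell_inject)
  then have "act ?A f_solved ?c = Some Yellow" "act ?F (act ?A f_solved) ?c = Some Blue"
    using act_apply[OF bij_qt, of _ _ _ ?d]
      act_apply[OF bij_qt, of _ _ f_solved "face_cell Yellow (Zero, Pos a)"]
    by (metis f_solved_face_cell)+
  ultimately show False by simp
qed

theorem theorem5p10:
  assumes "countable (UNIV :: 'l set)" and "infinite (UNIV :: 'l set)"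
  shows
    "(S_face :: 'l config set) \<subseteq> L_solved TYPE(nat)
     \<and> (\<exists>f. f \<in> (L_solved TYPE(nat) :: 'l config set) \<and> f \<notin> S_face)
     \<and> (L_solved TYPE('o) :: 'l config set) \<subseteq> S_std
     \<and> (\<forall>f\<in>(S_std :: 'l config set). \<forall>g\<in>S_face.
          \<exists>r :: (nat \<times> nat) rel. (r, omega2) \<in> ordLeq \<and> accessible_via r f g)
     \<and> (\<forall>(f :: 'l config) g. legal g \<and> g \<notin> S_std \<and> f \<in> S_std \<longrightarrow>
          \<not> accessible TYPE('o) f g \<and> \<not> accessible TYPE('o) g f)"
proof (intro conjI)
  have "accessible TYPE(nat) f_solved g" "legal g" if "g \<in> S_face" for g :: "'l config"
    using that accessible_S_face[OF assms bij_prod_decode _ that, of f_solved] standard_f_solved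
    by (auto simp: accessible_def S_std_def S_face_def standard_def)
  then show "(S_face :: 'l config set) \<subseteq> L_solved TYPE(nat)" by (auto simp: L_solved_def)
  show "\<exists>f. f \<in> (L_solved TYPE(nat) :: 'l config set) \<and> f \<notin> S_face"
    using act_f_solved_in_L_solved[OF qt_basic] twisted_f_solved_not_in_S_face by (intro exI conjI)
  show "(L_solved TYPE('o) :: 'l config set) \<subseteq> S_std"
    using accessible_standard_iff[where ?'o = 'o] legal_f_solved standard_f_solved
    unfolding L_solved_def S_std_def by blast
  show "\<forall>f\<in>(S_std :: 'l config set). \<forall>g\<in>S_face.
          \<exists>r :: (nat \<times> nat) rel. (r, omega2) \<in> ordLeq \<and> accessible_via r f g"
  proof (intro ballI exI conjI)
    fix f g :: "'l config" assume "f \<in> S_std" "g \<in> S_face"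
    then show "accessible_via omega2 f g"
      using accessible_S_face[OF assms bij_id] by (simp add: pull_omega2_def inv_image_def)
    then show "(omega2, omega2) \<in> ordLeq" by (simp add: accessible_via_def ordLeq_reflexive)
  qed
  show "\<forall>(f :: 'l config) g. legal g \<and> g \<notin> S_std \<and> f \<in> S_std \<longrightarrow>
          \<not> accessible TYPE('o) f g \<and> \<not> accessible TYPE('o) g f"
    using accessible_standard_iff[where ?'o = 'o] unfolding S_std_def standard_def by blast
qed

end
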